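(* Let $\mathfrak A$ be a unital $C^*$-algebra, $A$ a unital $\mathfrak A$-$C^*$-module and $n\ge1$. Then the assignment $\varphi\mapsto\hat\varphi$, $\hat\varphi([a_{ij}])=\sum_{i,j=1}^n\varphi(a_{ij})_{ij}$, is a bijection from $CP_{\mathfrak A}(A,\mathbb M_n(\mathfrak A))$ onto $CP_{\mathfrak A}(\mathbb M_n(A),\mathfrak A)$; that is, a module map $\varphi:A\to\mathbb M_n(\mathfrak A)$ is completely positive if and only if $\hat\varphi$ is completely positive.
   Context: An $\mathfrak A$-$C^*$-module is a $C^*$-algebra which is a left Banach $\mathfrak A$-module with contractive action satisfying $(\alpha\cdot a)^*=\alpha^*\cdot a^*$, $\alpha\cdot(ab)=(\alpha\cdot a)b$, $(\alpha\beta)\cdot a=\alpha\cdot(\beta\cdot a)$; it is unital if it is a unital $C^*$-algebra and the closed span of $\{\alpha\cdot a\}$ is $A$. $CP_{\mathfrak A}(X,Y)$ denotes the completely positive left $\mathfrak A$-module linear maps $X\to Y$. The actions are $\alpha\cdot[a_{ij}]=[\alpha\cdot a_{ij}]$ on $\mathbb M_n(A)$, $\alpha\cdot[\alpha_{ij}]=[\alpha\alpha_{ij}]$ on $\mathbb M_n(\mathfrak A)$, and left multiplication on $\mathfrak A$; $\varphi(a)_{ij}$ is the $(i,j)$ entry of $\varphi(a)$. *)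

theory Defs
  imports "HOL-Analysis.Analysis"
begin

section \<open>C*-algebras\<close>

text \<open>HOL has no complex vector spaces, so the complex scalar multiplication
  is an extra operation, compatible with the real one.\<close>

class cstar_algebra = real_normed_algebra + banach +
  fixes scC :: "complex \<Rightarrow> 'a \<Rightarrow> 'a"
    and adj :: "'a \<Rightarrow> 'a"
  assumes scC_add_right: "scC c (x + y) = scC c x + scC c y"
    and scC_add_left: "scC (c + d) x = scC c x + scC d x"
    and scC_scC: "scC c (scC d x) = scC (c * d) x"
    and scC_of_real: "scC (complex_of_real r) x = r *\<^sub>R x"
    and norm_scC: "norm (scC c x) = cmod c * norm x"
    and scC_mult_left: "scC c (x * y) = scC c x * y"
    and scC_mult_right: "scC c (x * y) = x * scC c y"
    and adj_adj: "adj (adj x) = x"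
    and adj_add: "adj (x + y) = adj x + adj y"
    and adj_scC: "adj (scC c x) = scC (cnj c) (adj x)"
    and adj_mult: "adj (x * y) = adj y * adj x"
    and cstar_identity: "norm (adj x * x) = norm x * norm x"

text \<open>Unital C*-algebra.\<close>
class unital_cstar_algebra = cstar_algebra + ring_1

section \<open>Positivity and complete positivity\<close>

text \<open>A k x k matrix (indices below k) over a *-algebra with multiplication
  mul and involution ad is positive iff it is of the form B* B.\<close>
definition mat_pos ::
  "('x \<Rightarrow> 'x \<Rightarrow> 'x) \<Rightarrow> ('x \<Rightarrow> 'x) \<Rightarrow> nat \<Rightarrow> (nat \<Rightarrow> nat \<Rightarrow> 'x::comm_monoid_add) \<Rightarrow> bool" where
  "mat_pos mul ad k M \<longleftrightarrow>
     (\<exists>B::nat \<Rightarrow> nat \<Rightarrow> 'x. \<forall>i<k. \<forall>j<k. M i j = (\<Sum>l<k. mul (ad (B l i)) (B l j)))"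

text \<open>Complete positivity: every amplification phi_k : M_k(X) -> M_k(Y) is positive.\<close>
definition completely_positive ::
  "('x \<Rightarrow> 'x \<Rightarrow> 'x) \<Rightarrow> ('x \<Rightarrow> 'x) \<Rightarrow> ('y \<Rightarrow> 'y \<Rightarrow> 'y) \<Rightarrow> ('y \<Rightarrow> 'y)
    \<Rightarrow> ('x::comm_monoid_add \<Rightarrow> 'y::comm_monoid_add) \<Rightarrow> bool" where
  "completely_positive mulX adX mulY adY f \<longleftrightarrow>
     (\<forall>k M. mat_pos mulX adX k M \<longrightarrow> mat_pos mulY adY k (\<lambda>i j. f (M i j)))"

section \<open>Matrices over a C*-algebra\<close>

definition madj :: "'a::cstar_algebra ^'n^'n \<Rightarrow> 'a^'n^'n" where
  "madj M = (\<chi> i j. adj (M $ j $ i))"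

definition mscC :: "complex \<Rightarrow> 'a::cstar_algebra ^'n^'m \<Rightarrow> 'a^'n^'m" where
  "mscC c M = (\<chi> i j. scC c (M $ i $ j))"

section \<open>Modules\<close>

text \<open>A (unital) 'u-C*-module structure on the unital C*-algebra 'a, given by
  the action act.\<close>
definition unital_AC_module ::
  "('u::unital_cstar_algebra \<Rightarrow> 'a::unital_cstar_algebra \<Rightarrow> 'a) \<Rightarrow> bool" where
  "unital_AC_module act \<longleftrightarrow>
     (\<forall>\<alpha> \<beta> a. act (\<alpha> + \<beta>) a = act \<alpha> a + act \<beta> a) \<and>
     (\<forall>\<alpha> a b. act \<alpha> (a + b) = act \<alpha> a + act \<alpha> b) \<and>
     (\<forall>c \<alpha> a. act (scC c \<alpha>) a = scC c (act \<alpha> a)) \<and>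
     (\<forall>c \<alpha> a. act \<alpha> (scC c a) = scC c (act \<alpha> a)) \<and>
     (\<forall>\<alpha> a. norm (act \<alpha> a) \<le> norm \<alpha> * norm a) \<and>
     (\<forall>\<alpha> a. adj (act \<alpha> a) = act (adj \<alpha>) (adj a)) \<and>
     (\<forall>\<alpha> a b. act \<alpha> (a * b) = act \<alpha> a * b) \<and>
     (\<forall>\<alpha> \<beta> a. act (\<alpha> * \<beta>) a = act \<alpha> (act \<beta> a)) \<and>
     closure (span {act \<alpha> a | \<alpha> a. True}) = UNIV"

text \<open>Left module linear maps, for given complex scalings and actions.\<close>
definition module_map ::
  "(complex \<Rightarrow> 'x \<Rightarrow> 'x) \<Rightarrow> ('u \<Rightarrow> 'x \<Rightarrow> 'x) \<Rightarrow> (complex \<Rightarrow> 'y \<Rightarrow> 'y) \<Rightarrow> ('u \<Rightarrow> 'y \<Rightarrow> 'y)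
    \<Rightarrow> ('x::plus \<Rightarrow> 'y::plus) \<Rightarrow> bool" where
  "module_map scX actX scY actY f \<longleftrightarrow>
     (\<forall>x y. f (x + y) = f x + f y) \<and>
     (\<forall>c x. f (scX c x) = scY c (f x)) \<and>
     (\<forall>\<alpha> x. f (actX \<alpha> x) = actY \<alpha> (f x))"

text \<open>The actions of 'u on M_n(A) (entrywise) and on M_n('u) (left multiplication
  of the entries), and on 'u itself (left multiplication).\<close>
definition mact :: "('u \<Rightarrow> 'a \<Rightarrow> 'a) \<Rightarrow> 'u \<Rightarrow> 'a^'n^'n \<Rightarrow> 'a^'n^'n" where
  "mact act \<alpha> M = (\<chi> i j. act \<alpha> (M $ i $ j))"

definition mlmult :: "'u::times \<Rightarrow> 'u^'n^'n \<Rightarrow> 'u^'n^'n" where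
  "mlmult \<alpha> M = (\<chi> i j. \<alpha> * M $ i $ j)"

text \<open>CP_U(X,Y) for the relevant pairs.\<close>
definition CP_A_Mn ::
  "('u::unital_cstar_algebra \<Rightarrow> 'a::unital_cstar_algebra \<Rightarrow> 'a)
     \<Rightarrow> ('a \<Rightarrow> 'u^'n::finite^'n) set" where
  "CP_A_Mn act = {\<phi>. module_map scC act mscC mlmult \<phi> \<and>
      completely_positive (*) adj (**) madj \<phi>}"

definition CP_MnA_U ::
  "('u::unital_cstar_algebra \<Rightarrow> 'a::unital_cstar_algebra \<Rightarrow> 'a)
     \<Rightarrow> ('a^'n::finite^'n \<Rightarrow> 'u) set" where
  "CP_MnA_U act = {\<psi>. module_map mscC (mact act) scC (*) \<psi> \<and>
      completely_positive (**) madj (*) adj \<psi>}"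

text \<open>The hat construction.\<close>
definition hat :: "('a \<Rightarrow> 'u::comm_monoid_add^'n::finite^'n) \<Rightarrow> 'a^'n^'n \<Rightarrow> 'u" where
  "hat \<phi> M = (\<Sum>i\<in>UNIV. \<Sum>j\<in>UNIV. \<phi> (M $ i $ j) $ i $ j)"

end

theory Submission
  imports Defs "HOL-Computational_Algebra.Formal_Power_Series"
begin

text \<open>The map \<open>hat\<close> is injective on maps vanishing at \<open>0\<close> and is inverted by
  \<open>\<psi> \<mapsto> (a \<mapsto> [\<psi> (E\<^sub>i\<^sub>j a)]\<^sub>i\<^sub>j)\<close>, which respects the module structures; so everything
  reduces to "\<open>\<phi>\<close> is CP iff \<open>hat \<phi>\<close> is CP". Both directions are reindexings: a positive
  matrix in \<open>M\<^sub>k(M\<^sub>n(A))\<close> is a positive \<open>k n \<times> k n\<close> matrix over \<open>A\<close>, and a positive matrix in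
  \<open>M\<^sub>k(A)\<close> spread over the matrix units \<open>E\<^sub>i\<^sub>j\<close> is a positive \<open>k n \<times> k n\<close> matrix over \<open>M\<^sub>n(A)\<close>.

  The one analytic ingredient is that a Gram matrix \<open>\<Sum>\<^sub>x y\<^sub>x\<^sup>* y\<^sub>x\<close> of finitely many vectors
  \<open>y\<^sub>x \<in> A\<^sup>k\<close> is again of the form \<open>B\<^sup>* B\<close> with \<open>B\<close> of size \<open>k \<times> k\<close>. This needs the theory of
  positive elements of a C*-algebra (square roots from the binomial series of \<open>\<surd>(1 - x)\<close>, and
  Kaplansky's theorem that \<open>x\<^sup>* x\<close> is positive); the same binomial series, applied to the
  contraction \<open>1 - P / t\<close> of the Hilbert module \<open>A\<^sup>k\<close>, then yields the square root of the
  Gram matrix \<open>P\<close>.\<close>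

section \<open>Elementary facts on C*-algebras\<close>

declare adj_adj[simp] adj_add[simp] adj_mult[simp]

context unital_cstar_algebra
begin

lemma adj_one: "adj 1 = 1"
  using adj_mult[of "adj 1" 1] by (metis adj_adj mult_1_right)

subclass real_normed_algebra_1
proof
  have "norm (1::'a) = norm (1::'a) * norm (1::'a)"
    using cstar_identity[of "1::'a"] by (simp add: adj_one)
  thus "norm (1::'a) = 1" by (metis mult_cancel_right1 norm_eq_zero one_neq_zero)
qed

end

lemma adj_zero [simp]: "adj (0::'a::cstar_algebra) = 0"
  by (metis add_cancel_right_right adj_add)

lemma adj_minus [simp]: "adj (- x) = - adj (x::'a::cstar_algebra)"
  by (metis add_eq_0_iff adj_add adj_zero add.right_inverse)

lemma adj_diff [simp]: "adj (x - y) = adj x - adj (y::'a::cstar_algebra)"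
  by (metis adj_add adj_minus diff_conv_add_uminus)

lemma adj_scaleR [simp]: "adj (r *\<^sub>R x) = r *\<^sub>R adj (x::'a::cstar_algebra)"
  by (metis adj_scC complex_cnj_complex_of_real scC_of_real)

lemma adj_sum [simp]: "adj (sum f A) = (\<Sum>i\<in>A. adj (f i :: 'a::cstar_algebra))"
  by (induction A rule: infinite_finite_induct) auto

lemma adj_of_real [simp]: "adj (of_real r :: 'a::unital_cstar_algebra) = of_real r"
  by (simp add: of_real_def adj_one)

lemma adj_power: "adj (x ^ n) = adj x ^ n" for x :: "'a::unital_cstar_algebra"
  by (induction n) (auto simp: power_commutes adj_one)

lemma norm_adj [simp]: "norm (adj x) = norm (x::'a::cstar_algebra)"
proof -
  have le: "norm y \<le> norm (adj y)" for y :: 'a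
  proof (cases "y = 0")
    case False
    have "norm y * norm y = norm (adj y * y)" by (simp add: cstar_identity)
    also have "\<dots> \<le> norm (adj y) * norm y" by (rule norm_mult_ineq)
    finally show ?thesis using False by simp
  qed simp
  show ?thesis using le[of x] le[of "adj x"] by simp
qed

lemma norm_adj_mult_self: "norm (adj x * x) = norm (x::'a::cstar_algebra) ^ 2"
  by (simp add: cstar_identity power2_eq_square)

lemma norm_mult_self_if_adj_eq: "adj x = x \<Longrightarrow> norm (x * x) = norm (x::'a::cstar_algebra) ^ 2"
  using norm_adj_mult_self[of x] by simp

lemma bounded_linear_adj: "bounded_linear (adj::'a::cstar_algebra \<Rightarrow> 'a)"
  by (rule bounded_linear_intro[where K=1]) auto

lemma scC_zero_left [simp]: "scC 0 x = (0::'a::cstar_algebra)"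
  by (metis scC_of_real scaleR_zero_left of_real_0)

lemma scC_one [simp]: "scC 1 x = (x::'a::cstar_algebra)"
  by (metis scC_of_real scaleR_one of_real_1)

lemma scC_zero_right [simp]: "scC c 0 = (0::'a::cstar_algebra)"
  by (metis add_cancel_right_right scC_add_right)

lemma scC_minus_right: "scC c (- x) = - scC c (x::'a::cstar_algebra)"
  by (metis add_eq_0_iff scC_add_right scC_zero_right add.right_inverse)

lemma scC_minus_left: "scC (- c) x = - scC c (x::'a::cstar_algebra)"
  by (metis add_eq_0_iff scC_add_left scC_zero_left add.right_inverse)

lemma scC_sum: "scC c (sum f A) = (\<Sum>x\<in>A. scC c (f x :: 'a::cstar_algebra))"
  by (induction A rule: infinite_finite_induct) (simp_all add: scC_add_right)

section \<open>The binomial series of the square root\<close>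

definition sqrt_coeff :: "nat \<Rightarrow> real" where
  "sqrt_coeff n = (-1) ^ n * ((1/2) gchoose n)"

lemma sqrt_coeff_Suc: "sqrt_coeff (Suc n) = sqrt_coeff n * ((real n - 1/2) / (real n + 1))"
proof -
  have "((1/2::real) gchoose Suc n) * (real n + 1) = - ((1/2) gchoose n) * (real n - 1/2)"
    using gbinomial_mult_1[of "1/2::real" n] by (simp add: algebra_simps)
  hence "((1/2::real) gchoose Suc n) = - ((1/2) gchoose n) * ((real n - 1/2) / (real n + 1))"
    by (simp add: field_simps)
  thus ?thesis by (simp add: sqrt_coeff_def)
qed

lemma sqrt_coeff_nonpos: "n \<ge> 1 \<Longrightarrow> sqrt_coeff n \<le> 0"
proof (induction n)
  case (Suc n)
  show ?case
  proof (cases "n = 0")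
    case False
    hence "sqrt_coeff n \<le> 0" "(real n - 1/2) / (real n + 1) \<ge> 0" using Suc by simp_all
    thus ?thesis unfolding sqrt_coeff_Suc by (rule mult_nonpos_nonneg)
  qed (simp add: sqrt_coeff_Suc sqrt_coeff_def)
qed simp

lemma sum_sqrt_coeff_nonneg: "(\<Sum>k\<le>m. sqrt_coeff k) \<ge> 0"
proof -
  have "(\<Sum>k\<le>m. sqrt_coeff k) = (\<Sum>k\<le>m. ((1/2::real) gchoose k) * (-1) ^ k)"
    by (simp add: sqrt_coeff_def mult.commute)
  also have "\<dots> = (-1) ^ m * ((1/2 - 1) gchoose m)" by (rule gbinomial_sum_lower_neg)
  also have "((1/2::real) - 1) gchoose m = (-1) ^ m * ((real m - 1/2) gchoose m)"
    by (subst gbinomial_negated_upper) simp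
  also have "(real m - 1/2) gchoose m = (\<Prod>i = 0..<m. (real m - 1/2 - of_nat i) / of_nat (m - i))"
    by (rule gbinomial_altdef_of_nat)
  finally have "(\<Sum>k\<le>m. sqrt_coeff k) = (\<Prod>i = 0..<m. (real m - 1/2 - of_nat i) / of_nat (m - i))"
    by (simp add: power_mult_distrib[symmetric])
  also have "\<dots> \<ge> 0" by (rule prod_nonneg) (auto simp: of_nat_diff)
  finally show ?thesis .
qed

lemma sum_abs_sqrt_coeff_le: "(\<Sum>k<n. \<bar>sqrt_coeff k\<bar>) \<le> 2"
proof -
  have "(\<Sum>k\<le>m. \<bar>sqrt_coeff k\<bar>) = 2 - (\<Sum>k\<le>m. sqrt_coeff k)" for m
  proof (induction m)
    case (Suc m)
    thus ?case using sqrt_coeff_nonpos[of "Suc m"] by simp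
  qed (simp add: sqrt_coeff_def)
  thus ?thesis using sum_sqrt_coeff_nonneg by (cases n) (auto simp: lessThan_Suc_atMost)
qed

lemma summable_abs_sqrt_coeff: "summable (\<lambda>n. \<bar>sqrt_coeff n\<bar>)"
  by (rule summableI_nonneg_bounded[OF _ sum_abs_sqrt_coeff_le]) simp

lemma suminf_abs_sqrt_coeff_le: "(\<Sum>n. \<bar>sqrt_coeff n\<bar>) \<le> 2"
  by (rule suminf_le_const[OF summable_abs_sqrt_coeff sum_abs_sqrt_coeff_le])

text \<open>The Cauchy square of the series is \<open>1 - x\<close>, by Vandermonde's identity.\<close>

lemma sqrt_coeff_convolution:
  "(\<Sum>i\<le>k. sqrt_coeff i * sqrt_coeff (k - i)) = (if k = 0 then 1 else if k = 1 then -1 else 0)"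
proof -
  have "(\<Sum>i\<le>k. sqrt_coeff i * sqrt_coeff (k - i))
      = (-1) ^ k * (\<Sum>i\<le>k. ((1/2::real) gchoose i) * ((1/2) gchoose (k - i)))"
    unfolding sqrt_coeff_def sum_distrib_left
    by (rule sum.cong) (auto simp: power_add[symmetric])
  also have "\<dots> = (-1) ^ k * (1 gchoose k)"
    using gbinomial_Vandermonde[of "1/2::real" "1/2" k] by (simp add: atLeast0AtMost)
  also have "(1::real) gchoose k = 0" if "k \<ge> 2"
  proof -
    have "(\<Prod>i = 0..<k. (1::real) - of_nat i) = 0"
      using that prod_zero[of "{0..<k}" "\<lambda>i. (1::real) - of_nat i"] by force
    thus ?thesis by (metis gbinomial_mult_fact fact_nonzero mult_eq_0_iff)
  qed
  finally show ?thesis by (cases "k = 0"; cases "k = 1") (auto simp: sqrt_coeff_def)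
qed

definition sqrt_one_minus :: "'a::{real_normed_algebra_1,banach} \<Rightarrow> 'a" where
  "sqrt_one_minus y = (\<Sum>n. sqrt_coeff n *\<^sub>R y ^ n)"

lemma norm_sqrt_series_term_le:
  "norm (y::'a::real_normed_algebra_1) \<le> 1 \<Longrightarrow> norm (sqrt_coeff n *\<^sub>R y ^ n) \<le> \<bar>sqrt_coeff n\<bar>"
  using norm_power_ineq[of y n] power_le_one[of "norm y" n] by (simp add: mult_left_le)

lemma summable_norm_sqrt_series:
  assumes "norm (y::'a::real_normed_algebra_1) \<le> 1"
  shows "summable (\<lambda>n. norm (sqrt_coeff n *\<^sub>R y ^ n))"
  using norm_sqrt_series_term_le[OF assms]
  by (intro summable_comparison_test[OF _ summable_abs_sqrt_coeff]) auto

lemma summable_sqrt_series: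
  "norm (y::'a::{real_normed_algebra_1,banach}) \<le> 1 \<Longrightarrow> summable (\<lambda>n. sqrt_coeff n *\<^sub>R y ^ n)"
  by (rule summable_norm_cancel[OF summable_norm_sqrt_series])

lemma sqrt_one_minus_square:
  assumes "norm (y::'a::{real_normed_algebra_1,banach}) \<le> 1"
  shows "sqrt_one_minus y * sqrt_one_minus y = 1 - y"
proof -
  have "sqrt_one_minus y * sqrt_one_minus y
      = (\<Sum>k. \<Sum>i\<le>k. (sqrt_coeff i *\<^sub>R y ^ i) * (sqrt_coeff (k - i) *\<^sub>R y ^ (k - i)))"
    unfolding sqrt_one_minus_def
    by (rule Cauchy_product[OF summable_norm_sqrt_series[OF assms] summable_norm_sqrt_series[OF assms]])
  also have "\<dots> = (\<Sum>k. (\<Sum>i\<le>k. sqrt_coeff i * sqrt_coeff (k - i)) *\<^sub>R y ^ k)"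
    unfolding scaleR_sum_left by (intro suminf_cong sum.cong) (auto simp: power_add[symmetric])
  also have "\<dots> = (\<Sum>k. if k = 0 then 1 else if k = 1 then - y else 0)"
    by (rule suminf_cong) (simp add: sqrt_coeff_convolution)
  also have "\<dots> = (\<Sum>k\<in>{0::nat,1}. if k = 0 then 1 else if k = 1 then - y else 0)"
    by (rule suminf_finite) auto
  finally show ?thesis by simp
qed

lemma sqrt_one_minus_commute:
  assumes "norm (y::'a::{real_normed_algebra_1,banach}) \<le> 1" "z * y = y * z"
  shows "z * sqrt_one_minus y = sqrt_one_minus y * z"
proof -
  have "z * sqrt_one_minus y = (\<Sum>n. z * (sqrt_coeff n *\<^sub>R y ^ n))"
    unfolding sqrt_one_minus_def by (rule suminf_mult[symmetric, OF summable_sqrt_series[OF assms(1)]])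
  also have "\<dots> = (\<Sum>n. (sqrt_coeff n *\<^sub>R y ^ n) * z)"
    using power_commuting_commutes[OF assms(2)[symmetric]] by (simp add: mult_scaleR_right)
  also have "\<dots> = sqrt_one_minus y * z"
    unfolding sqrt_one_minus_def by (rule suminf_mult2[symmetric, OF summable_sqrt_series[OF assms(1)]])
  finally show ?thesis .
qed

lemma adj_sqrt_one_minus:
  assumes "norm (y::'a::unital_cstar_algebra) \<le> 1" "adj y = y"
  shows "adj (sqrt_one_minus y) = sqrt_one_minus y"
  unfolding sqrt_one_minus_def
  using bounded_linear.suminf[OF bounded_linear_adj summable_sqrt_series[OF assms(1)]] assms(2)
  by (simp add: adj_power)

lemma norm_one_minus_sqrt_one_minus_le:
  assumes "norm (y::'a::{real_normed_algebra_1,banach}) \<le> 1"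
  shows "norm (1 - sqrt_one_minus y) \<le> 1"
proof -
  let ?f = "\<lambda>n. sqrt_coeff n *\<^sub>R y ^ n"
  have "sqrt_one_minus y = (\<Sum>n. ?f (n + 1)) + ?f 0"
    unfolding sqrt_one_minus_def using suminf_split_head[OF summable_sqrt_series[OF assms]] by simp
  hence "norm (1 - sqrt_one_minus y) = norm (\<Sum>n. ?f (n + 1))" by (simp add: sqrt_coeff_def)
  also have "\<dots> \<le> (\<Sum>n. norm (?f (n + 1)))"
    by (rule summable_norm)
       (rule summable_ignore_initial_segment[OF summable_norm_sqrt_series[OF assms]])
  also have "\<dots> \<le> (\<Sum>n. \<bar>sqrt_coeff (n + 1)\<bar>)"
    by (rule suminf_le[OF norm_sqrt_series_term_le[OF assms]])
       (rule summable_ignore_initial_segment[OF summable_norm_sqrt_series[OF assms]],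
        rule summable_ignore_initial_segment[OF summable_abs_sqrt_coeff])
  also have "\<dots> = (\<Sum>n. \<bar>sqrt_coeff n\<bar>) - 1"
    using suminf_split_head[OF summable_abs_sqrt_coeff] by (simp add: sqrt_coeff_def)
  also have "\<dots> \<le> 1" using suminf_abs_sqrt_coeff_le by simp
  finally show ?thesis .
qed

section \<open>Invertible elements\<close>

definition invertible_elem :: "'a::ring_1 \<Rightarrow> bool" where
  "invertible_elem x \<longleftrightarrow> (\<exists>y. x * y = 1 \<and> y * x = 1)"

lemma invertible_elem_commuting_factor:
  assumes "x * y = y * x" "invertible_elem (x * (y::'a::ring_1))"
  shows "invertible_elem x"
proof -
  obtain w where w: "x * y * w = 1" "w * (x * y) = 1"
    using assms(2) unfolding invertible_elem_def by blast
  have "x * (y * w) = 1" using w(1) by (simp add: mult.assoc)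
  moreover have "(w * y) * x = 1" using w(2) assms(1) by (metis mult.assoc)
  ultimately show ?thesis unfolding invertible_elem_def by (metis mult.assoc mult_1_left mult_1_right)
qed

lemma invertible_elem_scaleR:
  assumes "r \<noteq> 0" "invertible_elem (x::'a::real_algebra_1)"
  shows "invertible_elem (r *\<^sub>R x)"
proof -
  obtain y where "x * y = 1" "y * x = 1" using assms(2) unfolding invertible_elem_def by blast
  hence "(r *\<^sub>R x) * (inverse r *\<^sub>R y) = 1" "(inverse r *\<^sub>R y) * (r *\<^sub>R x) = 1"
    using assms(1) by simp_all
  thus ?thesis unfolding invertible_elem_def by blast
qed

text \<open>Jacobson's lemma: if \<open>w\<close> inverts \<open>r + x y\<close>, then \<open>(1 - y w x) / r\<close> inverts \<open>r + y x\<close>.\<close>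

lemma invertible_elem_of_real_add_swap:
  fixes x y :: "'a::real_algebra_1"
  assumes "r \<noteq> 0" "invertible_elem (of_real r + x * y)"
  shows "invertible_elem (of_real r + y * x)"
proof -
  obtain w where w: "(r *\<^sub>R 1 + x * y) * w = 1" "w * (r *\<^sub>R 1 + x * y) = 1"
    using assms(2) unfolding invertible_elem_def of_real_def by blast
  have "(r *\<^sub>R 1 + y * x) * (1 - y * w * x) = r *\<^sub>R 1 + y * x - y * ((r *\<^sub>R 1 + x * y) * w) * x"
    "(1 - y * w * x) * (r *\<^sub>R 1 + y * x) = r *\<^sub>R 1 + y * x - y * (w * (r *\<^sub>R 1 + x * y)) * x"
    by (simp_all add: algebra_simps mult.assoc)
  hence "(r *\<^sub>R 1 + y * x) * (1 - y * w * x) = r *\<^sub>R 1" "(1 - y * w * x) * (r *\<^sub>R 1 + y * x) = r *\<^sub>R 1"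
    using w by simp_all
  hence "(r *\<^sub>R 1 + y * x) * (inverse r *\<^sub>R (1 - y * w * x)) = 1"
    "(inverse r *\<^sub>R (1 - y * w * x)) * (r *\<^sub>R 1 + y * x) = 1"
    using assms(1) by (simp_all add: mult_scaleR_right mult_scaleR_left)
  thus ?thesis unfolding invertible_elem_def of_real_def by blast
qed

lemma invertible_elem_one_minus:
  fixes x :: "'a::{real_normed_algebra_1,banach}"
  assumes "norm x < 1"
  shows "invertible_elem (1 - x)"
proof -
  have "summable (\<lambda>n. norm (x ^ n))"
    by (rule summable_comparison_test[OF _ summable_geometric[of "norm x"]])
       (use assms norm_power_ineq in auto)
  hence s: "summable (\<lambda>n. x ^ n)" by (rule summable_norm_cancel)
  have tel: "(\<Sum>n. x ^ n - x ^ Suc n) = 1"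
    using sums_unique[OF telescope_sums'[OF LIMSEQ_power_zero[OF assms]]] by simp
  have "(1 - x) * (\<Sum>n. x ^ n) = (\<Sum>n. (1 - x) * x ^ n)" by (rule suminf_mult[symmetric, OF s])
  also have "\<dots> = (\<Sum>n. x ^ n - x ^ Suc n)" by (simp add: algebra_simps)
  finally have right: "(1 - x) * (\<Sum>n. x ^ n) = 1" using tel by simp
  have "(\<Sum>n. x ^ n) * (1 - x) = (\<Sum>n. x ^ n * (1 - x))" by (rule suminf_mult2[OF s])
  also have "\<dots> = (\<Sum>n. x ^ n - x ^ Suc n)" by (simp add: algebra_simps power_commutes)
  finally have left: "(\<Sum>n. x ^ n) * (1 - x) = 1" using tel by simp
  show ?thesis unfolding invertible_elem_def using left right by blast
qed

section \<open>Positive elements\<close>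

text \<open>A metric characterisation of positivity that needs no spectral theory: for self-adjoint
  \<open>a\<close>, \<open>\<parallel>t - a\<parallel> \<le> t\<close> says that the spectrum of \<open>a\<close> lies in \<open>[0, 2t]\<close>.\<close>

definition cstar_pos :: "'a::unital_cstar_algebra \<Rightarrow> bool" where
  "cstar_pos a \<longleftrightarrow> adj a = a \<and> (\<exists>t\<ge>0. norm (of_real t - a) \<le> t)"

abbreviation cstar_le :: "'a::unital_cstar_algebra \<Rightarrow> 'a \<Rightarrow> bool" where
  "cstar_le a b \<equiv> cstar_pos (b - a)"

lemma cstar_pos_adj: "cstar_pos a \<Longrightarrow> adj a = a"
  by (simp add: cstar_pos_def)

lemma cstar_pos_add:
  assumes "cstar_pos a" "cstar_pos b"
  shows "cstar_pos (a + b)"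
proof -
  obtain t s where "t \<ge> 0" "norm (of_real t - a) \<le> t" "s \<ge> 0" "norm (of_real s - b) \<le> s"
    using assms unfolding cstar_pos_def by blast
  moreover have "norm (of_real (t + s) - (a + b)) \<le> norm (of_real t - a) + norm (of_real s - b)"
    by (metis add_diff_add norm_triangle_ineq of_real_add)
  ultimately show ?thesis
    using assms unfolding cstar_pos_def by (intro conjI exI[where x="t + s"]) auto
qed

lemma cstar_pos_scaleR:
  assumes "r \<ge> 0" "cstar_pos a"
  shows "cstar_pos (r *\<^sub>R a)"
proof -
  obtain t where t: "t \<ge> 0" "norm (of_real t - a) \<le> t"
    using assms unfolding cstar_pos_def by blast
  have "of_real (r * t) - r *\<^sub>R a = r *\<^sub>R (of_real t - a)"
    by (simp add: scaleR_diff_right of_real_def)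
  hence "norm (of_real (r * t) - r *\<^sub>R a) \<le> r * t"
    using t assms(1) by (simp add: mult_left_mono)
  thus ?thesis
    using assms t unfolding cstar_pos_def by (intro conjI exI[where x="r * t"]) auto
qed

lemma cstar_pos_of_real: "r \<ge> 0 \<Longrightarrow> cstar_pos (of_real r :: 'a::unital_cstar_algebra)"
  unfolding cstar_pos_def by (intro conjI exI[where x=r]) auto

lemma cstar_pos_zero [simp]: "cstar_pos (0::'a::unital_cstar_algebra)"
  using cstar_pos_of_real[of 0] by simp

lemma cstar_pos_sum:
  "(\<And>i. i \<in> A \<Longrightarrow> cstar_pos (f i)) \<Longrightarrow> cstar_pos (sum f A :: 'a::unital_cstar_algebra)"
  by (induction A rule: infinite_finite_induct) (auto intro: cstar_pos_add)

lemma cstar_le_trans: "cstar_le a b \<Longrightarrow> cstar_le b c \<Longrightarrow> cstar_le a (c::'a::unital_cstar_algebra)"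
  using cstar_pos_add[of "b - a" "c - b"] by simp

lemma cstar_le_scaleR: "r \<ge> 0 \<Longrightarrow> cstar_le a b \<Longrightarrow> cstar_le (r *\<^sub>R a) (r *\<^sub>R (b::'a::unital_cstar_algebra))"
  using cstar_pos_scaleR[of r "b - a"] by (simp add: scaleR_diff_right)

lemma cstar_le_sum:
  "(\<And>i. i \<in> A \<Longrightarrow> cstar_le (f i) (g i)) \<Longrightarrow> cstar_le (sum f A) (sum g A :: 'a::unital_cstar_algebra)"
  using cstar_pos_sum[of A "\<lambda>i. g i - f i"] by (simp add: sum_subtractf)

lemma cstar_pos_norm_minus: "adj a = a \<Longrightarrow> cstar_pos (of_real (norm a) - a :: 'a::unital_cstar_algebra)"
  unfolding cstar_pos_def by (intro conjI exI[where x="norm a"]) auto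

lemma cstar_pos_sqrt:
  fixes a :: "'a::unital_cstar_algebra"
  assumes "cstar_pos a"
  obtains b where "cstar_pos b" "b * b = a" "\<And>z. z * a = a * z \<Longrightarrow> z * b = b * z"
proof -
  obtain t where t: "t \<ge> 0" "norm (of_real t - a) \<le> t" and sa: "adj a = a"
    using assms unfolding cstar_pos_def by blast
  show ?thesis
  proof (cases "t = 0")
    case True
    hence "a = 0" using t by simp
    thus ?thesis by (intro that[of 0]) auto
  next
    case False
    hence tp: "t > 0" using t by simp
    define y where "y = (1/t) *\<^sub>R (of_real t - a)"
    have ny: "norm y \<le> 1" unfolding y_def using t tp by (simp add: divide_le_eq_1)
    have sy: "adj y = y" unfolding y_def using sa by simp
    define s where "s = sqrt_one_minus y"
    have "cstar_pos s"
      using norm_one_minus_sqrt_one_minus_le[OF ny] adj_sqrt_one_minus[OF ny sy]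
      unfolding cstar_pos_def s_def by (intro conjI exI[where x=1]) auto
    moreover have "(sqrt t *\<^sub>R s) * (sqrt t *\<^sub>R s) = a"
      using sqrt_one_minus_square[OF ny] t tp
      by (simp add: s_def y_def of_real_def scaleR_diff_right)
    moreover have "z * (sqrt t *\<^sub>R s) = (sqrt t *\<^sub>R s) * z" if "z * a = a * z" for z
    proof -
      have "z * y = y * z" unfolding y_def of_real_def using that by (simp add: algebra_simps)
      thus ?thesis unfolding s_def by (simp add: sqrt_one_minus_commute[OF ny])
    qed
    ultimately show ?thesis using t by (intro that[of "sqrt t *\<^sub>R s"] cstar_pos_scaleR) auto
  qed
qed

text \<open>\<open>u = v + i w\<close> satisfies \<open>u\<^sup>* u = 1\<close>, so \<open>\<parallel>u\<parallel> = 1\<close>, and \<open>v = (u + u\<^sup>*) / 2\<close>.\<close>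

lemma norm_le_1_if_sum_squares_eq_1:
  fixes v w :: "'a::unital_cstar_algebra"
  assumes "adj v = v" "adj w = w" "v * w = w * v" "v * v + w * w = 1"
  shows "norm v \<le> 1"
proof -
  define u where "u = v + scC \<i> w"
  have au: "adj u = v + scC (- \<i>) w" unfolding u_def using assms by (simp add: adj_scC)
  have "adj u * u = (v + scC (- \<i>) w) * (v + scC \<i> w)" by (simp only: au) (simp add: u_def)
  also have "\<dots> = v * v + v * scC \<i> w + scC (- \<i>) w * v + scC (- \<i>) w * scC \<i> w"
    by (simp add: algebra_simps)
  also have "v * scC \<i> w = scC \<i> (v * w)" by (simp add: scC_mult_right)
  also have "scC (- \<i>) w * v = - scC \<i> (v * w)"
    by (simp add: scC_mult_left scC_minus_left assms(3))
  also have "scC (- \<i>) w * scC \<i> w = w * w"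
    by (simp add: scC_mult_left scC_mult_right[symmetric] scC_scC)
  finally have "adj u * u = 1" using assms(4) by simp
  hence "norm u ^ 2 = 1" using norm_adj_mult_self[of u] by simp
  hence nu: "norm u = 1" using norm_ge_zero[of u] by (simp add: power2_eq_1_iff)
  have "u + adj u = 2 *\<^sub>R v" by (simp only: au) (simp add: u_def scC_minus_left scaleR_2)
  hence "v = (1/2) *\<^sub>R (u + adj u)" by simp
  hence "norm v \<le> (1/2) * (norm u + norm (adj u))"
    by (metis norm_scaleR norm_triangle_ineq abs_of_nonneg less_eq_real_def divide_pos_pos
        zero_less_one zero_less_numeral mult_left_mono)
  thus ?thesis using nu by simp
qed

text \<open>For \<open>\<parallel>h\<parallel> = 1\<close>, \<open>g = \<surd>(1 - h\<^sup>2)\<close> commutes with \<open>h\<close> and \<open>g\<^sup>2 + h\<^sup>2 = 1\<close>, so \<open>\<parallel>1 - h\<^sup>2\<parallel> = \<parallel>g\<parallel>\<^sup>2 \<le> 1\<close>.\<close>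

lemma norm_of_real_minus_square_le:
  fixes h :: "'a::unital_cstar_algebra"
  assumes "adj h = h"
  shows "norm (of_real (norm h ^ 2) - h * h) \<le> norm h ^ 2"
proof (cases "h = 0")
  case False
  define m where "m = norm h"
  have mp: "m > 0" unfolding m_def using False by simp
  define h' where "h' = (1/m) *\<^sub>R h"
  have "norm h' = 1" unfolding h'_def m_def using False by simp
  hence ny: "norm (h' * h') \<le> 1" using norm_mult_ineq[of h' h'] by simp
  have sh': "adj h' = h'" unfolding h'_def using assms by simp
  define g where "g = sqrt_one_minus (h' * h')"
  have gg: "g * g = 1 - h' * h'" unfolding g_def by (rule sqrt_one_minus_square[OF ny])
  have sg: "adj g = g" unfolding g_def by (rule adj_sqrt_one_minus[OF ny]) (simp add: sh')
  have "h' * g = g * h'" unfolding g_def by (rule sqrt_one_minus_commute[OF ny]) (simp add: mult.assoc)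
  hence "norm g \<le> 1" using sg sh' gg by (intro norm_le_1_if_sum_squares_eq_1) auto
  hence "norm (1 - h' * h') \<le> 1"
    using norm_mult_self_if_adj_eq[OF sg] gg by (simp add: power_le_one)
  moreover have "of_real (m ^ 2) - h * h = (m ^ 2) *\<^sub>R (1 - h' * h')"
    unfolding h'_def of_real_def using mp by (simp add: scaleR_diff_right power2_eq_square)
  ultimately show ?thesis unfolding m_def[symmetric] by (simp add: mult_left_le)
qed simp

lemma cstar_pos_square: "adj h = h \<Longrightarrow> cstar_pos (h * (h::'a::unital_cstar_algebra))"
  unfolding cstar_pos_def using norm_of_real_minus_square_le[of h]
  by (intro conjI exI[where x="norm h ^ 2"]) auto

lemma cstar_pos_norm_ge:
  fixes a :: "'a::unital_cstar_algebra"
  assumes "cstar_pos a" "s \<ge> norm a"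
  shows "norm (of_real s - a) \<le> s"
proof -
  obtain b where b: "cstar_pos b" "b * b = a" using cstar_pos_sqrt[OF assms(1)] by blast
  have sb: "adj b = b" using cstar_pos_adj[OF b(1)] .
  have na: "norm a = norm b ^ 2" using norm_mult_self_if_adj_eq[OF sb] b(2) by simp
  have "of_real s - a = of_real (s - norm a) + (of_real (norm b ^ 2) - b * b)"
    using na b(2) by (simp add: of_real_diff)
  hence "norm (of_real s - a) \<le> (s - norm a) + norm (of_real (norm b ^ 2) - b * b)"
    using assms(2) by (metis norm_triangle_ineq norm_of_real abs_of_nonneg diff_ge_0_iff_ge)
  thus ?thesis using norm_of_real_minus_square_le[OF sb] na by linarith
qed

lemma cstar_pos_mult_commuting:
  fixes a b :: "'a::unital_cstar_algebra"
  assumes "cstar_pos a" "cstar_pos b" "a * b = b * a"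
  shows "cstar_pos (a * b)"
proof -
  obtain h where h: "cstar_pos h" "h * h = a" "\<And>z. z * a = a * z \<Longrightarrow> z * h = h * z"
    using cstar_pos_sqrt[OF assms(1)] by blast
  obtain r where r: "cstar_pos r" "r * r = b" "\<And>z. z * b = b * z \<Longrightarrow> z * r = r * z"
    using cstar_pos_sqrt[OF assms(2)] by blast
  have "b * h = h * b" using h(3) assms(3) by simp
  hence hr: "h * r = r * h" using r(3) by simp
  have "(r * h) * (r * h) = (r * r) * (h * h)" by (metis hr mult.assoc)
  moreover have "adj (r * h) = r * h" using cstar_pos_adj[OF r(1)] cstar_pos_adj[OF h(1)] hr by simp
  ultimately show ?thesis using cstar_pos_square[of "r * h"] r(2) h(2) assms(3) by simp
qed

lemma cstar_pos_inverse:
  fixes g :: "'a::unital_cstar_algebra"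
  assumes "cstar_pos g" "g * g' = 1" "g' * g = 1"
  shows "cstar_pos g'"
proof -
  have "g' = (adj g' * g) * g'" using arg_cong[OF assms(2), of adj] cstar_pos_adj[OF assms(1)]
    by (simp add: adj_one)
  hence sg': "adj g' = g'" using assms(2) by (simp add: mult.assoc)
  obtain h where h: "cstar_pos h" "h * h = g" "\<And>z. z * g = g * z \<Longrightarrow> z * h = h * z"
    using cstar_pos_sqrt[OF assms(1)] by blast
  have hg': "g' * h = h * g'" using h(3) assms(2,3) by simp
  have "(h * g') * (h * g') = (h * h) * g' * g'" by (metis hg' mult.assoc)
  hence "(h * g') * (h * g') = g'" using h(2) assms(2) by simp
  moreover have "adj (h * g') = h * g'" using cstar_pos_adj[OF h(1)] sg' hg' by simp
  ultimately show ?thesis using cstar_pos_square[of "h * g'"] by simp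
qed

text \<open>The square roots \<open>v\<close> of \<open>a\<close> and \<open>w\<close> of \<open>d - a\<close> commute and \<open>(v\<^sup>2 + w\<^sup>2) / d = 1\<close>, whence
  \<open>\<parallel>a\<parallel> = \<parallel>v\<parallel>\<^sup>2 \<le> d\<close> for every \<open>d > c\<close>.\<close>

lemma norm_le_if_cstar_le_of_real:
  fixes a :: "'a::unital_cstar_algebra"
  assumes "cstar_pos a" "c \<ge> 0" "cstar_le a (of_real c)"
  shows "norm a \<le> c"
proof (rule field_le_epsilon)
  fix e :: real assume "e > 0"
  define d where "d = c + e"
  have dp: "d > 0" unfolding d_def using \<open>e > 0\<close> assms(2) by simp
  have "cstar_pos (of_real d - a)"
    using cstar_pos_add[OF assms(3) cstar_pos_of_real[of e]] \<open>e > 0\<close>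
    by (simp add: d_def algebra_simps)
  then obtain w where w: "cstar_pos w" "w * w = of_real d - a"
    "\<And>z. z * (of_real d - a) = (of_real d - a) * z \<Longrightarrow> z * w = w * z"
    using cstar_pos_sqrt by blast
  obtain v where v: "cstar_pos v" "v * v = a" "\<And>z. z * a = a * z \<Longrightarrow> z * v = v * z"
    using cstar_pos_sqrt[OF assms(1)] by blast
  have "v * a = a * v" using v(2) by (metis mult.assoc)
  hence "v * (of_real d - a) = (of_real d - a) * v" by (simp add: algebra_simps of_real_def)
  hence vw: "v * w = w * v" using w(3) by simp
  define v' where "v' = (1 / sqrt d) *\<^sub>R v"
  define w' where "w' = (1 / sqrt d) *\<^sub>R w"
  have "v' * v' + w' * w' = (1 / d) *\<^sub>R (v * v + w * w)"
    unfolding v'_def w'_def using dp by (simp add: scaleR_add_right)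
  also have "\<dots> = 1" using v(2) w(2) dp by (simp add: of_real_def)
  moreover have "adj v' = v'" "adj w' = w'" "v' * w' = w' * v'"
    using vw cstar_pos_adj[OF v(1)] cstar_pos_adj[OF w(1)] by (simp_all add: v'_def w'_def)
  ultimately have "norm v' \<le> 1" using norm_le_1_if_sum_squares_eq_1 by metis
  hence "norm v \<le> sqrt d" unfolding v'_def using dp by (simp add: divide_le_eq)
  hence "norm v ^ 2 \<le> d" using dp by (metis norm_ge_zero power_mono real_sqrt_pow2 less_imp_le)
  thus "norm a \<le> c + e"
    using norm_mult_self_if_adj_eq[OF cstar_pos_adj[OF v(1)]] v(2) dp by (simp add: d_def)
qed

lemma norm_le_norm_if_cstar_le:
  fixes a b :: "'a::unital_cstar_algebra"
  assumes "cstar_pos a" "cstar_le a b"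
  shows "norm a \<le> norm b"
proof -
  have "adj b = b" using cstar_pos_adj[OF cstar_pos_add[OF assms]] by simp
  hence "cstar_pos ((of_real (norm b) - b) + (b - a))"
    by (intro cstar_pos_add[OF cstar_pos_norm_minus assms(2)])
  thus ?thesis using norm_le_if_cstar_le_of_real[OF assms(1)] by simp
qed

lemma invertible_elem_of_real_add:
  fixes a :: "'a::unital_cstar_algebra"
  assumes "cstar_pos a" "l > 0"
  shows "invertible_elem (of_real l + a)"
proof -
  obtain t where t: "t \<ge> 0" "norm (of_real t - a) \<le> t"
    using assms unfolding cstar_pos_def by blast
  define x where "x = (1 / (l + t)) *\<^sub>R (of_real t - a)"
  have "norm x \<le> t / (l + t)" unfolding x_def using t assms(2) by (simp add: divide_right_mono)
  also have "\<dots> < 1" using t assms(2) by simp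
  finally have "invertible_elem ((l + t) *\<^sub>R (1 - x))"
    using t assms(2) by (intro invertible_elem_scaleR invertible_elem_one_minus) auto
  moreover have "(l + t) *\<^sub>R (1 - x) = (l + t) *\<^sub>R 1 - ((l + t) * (1 / (l + t))) *\<^sub>R (of_real t - a)"
    unfolding x_def by (simp only: scaleR_diff_right scaleR_scaleR)
  hence "(l + t) *\<^sub>R (1 - x) = of_real l + a"
    using t assms(2) by (simp add: of_real_def algebra_simps)
  ultimately show ?thesis by simp
qed

lemma cstar_pos_minus_inverse_norm:
  fixes g :: "'a::unital_cstar_algebra"
  assumes g: "cstar_pos g" and inv: "g * g' = 1" "g' * g = 1"
  shows "cstar_pos (g - of_real (1 / norm g'))"
proof -
  have pos_g': "cstar_pos g'" by (rule cstar_pos_inverse[OF g inv])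
  have "g' \<noteq> 0" using inv by auto
  hence M: "norm g' > 0" by simp
  have "cstar_pos ((of_real (norm g') - g') * g)"
    using g cstar_pos_norm_minus[OF cstar_pos_adj[OF pos_g']] inv
    by (intro cstar_pos_mult_commuting) (auto simp: algebra_simps of_real_def)
  hence "cstar_pos ((1 / norm g') *\<^sub>R ((of_real (norm g') - g') * g))"
    using M by (intro cstar_pos_scaleR) auto
  moreover have "(of_real (norm g') - g') * g = norm g' *\<^sub>R g - 1"
    using inv(2) by (simp add: left_diff_distrib of_real_def)
  ultimately show ?thesis using M by (simp add: scaleR_diff_right of_real_def)
qed

text \<open>If \<open>\<parallel>u\<parallel> - u\<close> had an inverse, \<open>g = 1 - u / \<parallel>u\<parallel>\<close> would be bounded below by
  \<open>1 / \<parallel>g\<^sup>-\<^sup>1\<parallel>\<close>, forcing \<open>\<parallel>u\<parallel> < \<parallel>u\<parallel>\<close>.\<close>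

lemma not_invertible_norm_minus:
  fixes u :: "'a::unital_cstar_algebra"
  assumes u: "cstar_pos u"
  shows "\<not> invertible_elem (of_real (norm u) - u)"
proof
  assume inv: "invertible_elem (of_real (norm u) - u)"
  define m where "m = norm u"
  have "u \<noteq> 0" using inv by (auto simp: invertible_elem_def)
  hence mp: "m > 0" unfolding m_def by simp
  define g where "g = (1/m) *\<^sub>R (of_real m - u)"
  have "cstar_pos g" unfolding g_def m_def using mp cstar_pos_adj[OF u]
    by (intro cstar_pos_scaleR cstar_pos_norm_minus) (auto simp: m_def)
  moreover have "norm g \<le> 1"
    unfolding g_def using cstar_pos_norm_ge[OF u, of m] mp by (simp add: m_def divide_le_eq_1)
  moreover obtain g' where g': "g * g' = 1" "g' * g = 1"
    using invertible_elem_scaleR[OF _ inv, of "1/m"] mp unfolding invertible_elem_def g_def m_def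
    by auto
  ultimately have M: "1 \<le> norm g'" and "cstar_pos (g - of_real (1 / norm g'))"
    using norm_mult_ineq[of g g'] mult_left_le_one_le[of "norm g'" "norm g"]
      cstar_pos_minus_inverse_norm[of g g']
    by auto
  hence "cstar_pos (m *\<^sub>R (g - of_real (1 / norm g')))" using mp by (intro cstar_pos_scaleR) auto
  moreover have "m *\<^sub>R (g - of_real (1 / norm g')) = of_real (m - m / norm g') - u"
    unfolding g_def using mp by (simp add: scaleR_diff_right scaleR_diff_left of_real_def)
  moreover have "m - m / norm g' \<ge> 0" using divide_left_mono[of 1 "norm g'" m] mp M by force
  ultimately have "norm u \<le> m - m / norm g'" using norm_le_if_cstar_le_of_real[OF u] by metis
  thus False using mp M by (simp add: m_def divide_le_0_iff)
qed

lemma cstar_pos_if_invertible: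
  fixes a :: "'a::unital_cstar_algebra"
  assumes sa: "adj a = a" and inv: "\<And>l. l > 0 \<Longrightarrow> invertible_elem (of_real l + a)"
  shows "cstar_pos a"
proof -
  define v where "v = of_real (norm a) - a"
  have "norm v \<le> norm a"
  proof (rule ccontr)
    assume "\<not> norm v \<le> norm a"
    hence "invertible_elem (of_real (norm v - norm a) + a)" by (intro inv) simp
    moreover have "of_real (norm v - norm a) + a = of_real (norm v) - v"
      by (simp add: v_def of_real_diff)
    ultimately show False
      using not_invertible_norm_minus[OF cstar_pos_norm_minus[OF sa], folded v_def] by metis
  qed
  thus ?thesis unfolding cstar_pos_def v_def using sa by (intro conjI exI[where x="norm a"]) auto
qed

section \<open>Kaplansky's theorem\<close>

lemma cstar_pos_adj_mult_self_if_skew: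
  fixes x :: "'a::unital_cstar_algebra"
  assumes "adj x = - x"
  shows "cstar_pos (adj x * x)"
proof -
  define h where "h = scC (- \<i>) x"
  have "adj h = h" unfolding h_def using assms by (simp add: adj_scC scC_minus_right scC_minus_left)
  have "h * h = scC (- \<i>) (scC (- \<i>) (x * x))"
    unfolding h_def by (simp only: scC_mult_left scC_mult_right[symmetric])
  also have "\<dots> = scC (- 1) (x * x)" by (simp add: scC_scC)
  also have "\<dots> = adj x * x" using assms by (simp only: scC_minus_left scC_one) simp
  finally show ?thesis using cstar_pos_square[OF \<open>adj h = h\<close>] by simp
qed

text \<open>Write \<open>y = s + k\<close> with \<open>s\<close> self-adjoint and \<open>k\<close> skew; then
  \<open>y y\<^sup>* + y\<^sup>* y = 2 s\<^sup>2 + 2 k\<^sup>* k\<close>.\<close>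

lemma cstar_pos_mult_adj_if_neg:
  fixes y :: "'a::unital_cstar_algebra"
  assumes "cstar_pos (- (adj y * y))"
  shows "cstar_pos (y * adj y)"
proof -
  define s where "s = (1/2) *\<^sub>R (y + adj y)"
  define k where "k = (1/2) *\<^sub>R (y - adj y)"
  have ss: "adj s = s" unfolding s_def by (simp add: add.commute)
  have sk: "adj k = - k" unfolding k_def by (simp add: algebra_simps)
  have "s + k = (1/2) *\<^sub>R ((y + adj y) + (y - adj y))"
    "s - k = (1/2) *\<^sub>R ((y + adj y) - (y - adj y))"
    unfolding s_def k_def by (simp_all only: scaleR_add_right scaleR_diff_right)
  hence ys: "y = s + k" "adj y = s - k" by (simp_all flip: scaleR_2)
  have yy: "y * adj y = (s + k) * (s - k)" "adj y * y = (s - k) * (s + k)"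
    by (subst ys(2), subst ys(1), rule refl)+
  have kk: "adj k * k = - (k * k)" using sk by simp
  have "y * adj y = 2 *\<^sub>R (s * s) + 2 *\<^sub>R (adj k * k) + (- (adj y * y))"
    unfolding yy kk by (simp add: algebra_simps scaleR_2)
  moreover have "cstar_pos (2 *\<^sub>R (s * s) + 2 *\<^sub>R (adj k * k) + (- (adj y * y)))"
    by (intro cstar_pos_add cstar_pos_scaleR cstar_pos_square[OF ss]
        cstar_pos_adj_mult_self_if_skew[OF sk] assms) auto
  ultimately show ?thesis by simp
qed

text \<open>For \<open>y \<noteq> 0\<close> and \<open>m = \<parallel>y\<^sup>* y\<parallel>\<close>, \<open>m + y y\<^sup>*\<close> is invertible, hence so is \<open>m + y\<^sup>* y\<close> by Jacobson's
  lemma; but that is \<open>\<parallel>u\<parallel> - u\<close> for the positive element \<open>u = - y\<^sup>* y\<close>.\<close>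

lemma eq_0_if_cstar_pos_neg:
  fixes y :: "'a::unital_cstar_algebra"
  assumes pos: "cstar_pos (- (adj y * y))"
  shows "y = 0"
proof (rule ccontr)
  assume "y \<noteq> 0"
  define m where "m = norm (- (adj y * y))"
  have mp: "m > 0" using \<open>y \<noteq> 0\<close> unfolding m_def by (simp add: norm_adj_mult_self)
  have "invertible_elem (of_real m + y * adj y)"
    by (rule invertible_elem_of_real_add[OF cstar_pos_mult_adj_if_neg[OF pos] mp])
  hence "invertible_elem (of_real m + adj y * y)"
    using invertible_elem_of_real_add_swap[of m y "adj y"] mp by simp
  thus False using not_invertible_norm_minus[OF pos] by (simp add: m_def)
qed

text \<open>With \<open>k = |a|\<close>, the elements \<open>P = k + a\<close> and \<open>N = k - a\<close> are orthogonal; they are positive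
  because \<open>(l + P)(l + N) = l (l + 2k)\<close> is invertible for \<open>l > 0\<close>.\<close>

lemma cstar_pos_decomposition:
  fixes a :: "'a::unital_cstar_algebra"
  assumes sa: "adj a = a"
  obtains P N where "cstar_pos P" "cstar_pos N" "N * P = 0" "P * N = 0" "a = (1/2) *\<^sub>R (P - N)"
proof -
  obtain k where k: "cstar_pos k" "k * k = a * a" "\<And>z. z * (a * a) = (a * a) * z \<Longrightarrow> z * k = k * z"
    using cstar_pos_sqrt[OF cstar_pos_square[OF sa]] by blast
  have ak: "a * k = k * a" using k(3) by (simp add: mult.assoc)
  define P where "P = k + a"
  define N where "N = k - a"
  have PN: "P * N = 0" "N * P = 0" unfolding P_def N_def using k(2) ak by (simp_all add: algebra_simps)
  have prod: "(of_real l + P) * (of_real l + N) = l *\<^sub>R (of_real l + 2 *\<^sub>R k)"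
    "(of_real l + N) * (of_real l + P) = l *\<^sub>R (of_real l + 2 *\<^sub>R k)" for l :: real
    unfolding of_real_def using PN by (simp_all add: algebra_simps P_def N_def scaleR_2)
  have inv: "invertible_elem ((of_real l + P) * (of_real l + N))"
    "invertible_elem ((of_real l + N) * (of_real l + P))" if "l > 0" for l :: real
    unfolding prod using that invertible_elem_of_real_add[OF cstar_pos_scaleR[OF _ k(1)], of 2 l]
    by (auto intro: invertible_elem_scaleR)
  have "cstar_pos P"
  proof (rule cstar_pos_if_invertible)
    show "adj P = P" by (simp add: P_def cstar_pos_adj[OF k(1)] sa)
    show "invertible_elem (of_real l + P)" if "l > 0" for l
      by (rule invertible_elem_commuting_factor[OF _ inv(1)[OF that]]) (simp only: prod)
  qed
  moreover have "cstar_pos N"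
  proof (rule cstar_pos_if_invertible)
    show "adj N = N" by (simp add: N_def cstar_pos_adj[OF k(1)] sa)
    show "invertible_elem (of_real l + N)" if "l > 0" for l
      by (rule invertible_elem_commuting_factor[OF _ inv(2)[OF that]]) (simp only: prod)
  qed
  moreover have "a = (1/2) *\<^sub>R (P - N)" unfolding P_def N_def by (simp flip: scaleR_2)
  ultimately show ?thesis using PN that by blast
qed

text \<open>With \<open>x\<^sup>* x = (P - N) / 2\<close> as above and \<open>y = x N\<close>, \<open>-y\<^sup>* y = N\<^sup>3 / 2 \<ge> 0\<close>, so \<open>N = 0\<close>.\<close>

theorem cstar_pos_adj_mult_self: "cstar_pos (adj x * (x::'a::unital_cstar_algebra))"
proof -
  obtain P N where PN: "cstar_pos P" "cstar_pos N" "N * P = 0" "P * N = 0"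
    and a: "adj x * x = (1/2) *\<^sub>R (P - N)"
    using cstar_pos_decomposition[of "adj x * x"] by auto
  have sN: "adj N = N" using cstar_pos_adj[OF PN(2)] .
  have "cstar_pos (N * (N * N))"
    using PN(2) cstar_pos_square[OF sN] by (intro cstar_pos_mult_commuting) (auto simp: mult.assoc)
  moreover have "- (adj (x * N) * (x * N)) = (1/2) *\<^sub>R (N * (N * N))"
  proof -
    have "adj (x * N) * (x * N) = N * (adj x * x) * N" using sN by (simp add: mult.assoc)
    also have "\<dots> = (1/2) *\<^sub>R (N * P * N - N * N * N)" unfolding a by (simp add: algebra_simps)
    finally show ?thesis using PN(3) by (simp add: mult.assoc)
  qed
  ultimately have "x * N = 0" by (intro eq_0_if_cstar_pos_neg) (simp add: cstar_pos_scaleR)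
  hence "(N * N) * (N * N) = 0"
    using \<open>- (adj (x * N) * (x * N)) = _\<close> by (simp add: mult.assoc)
  hence "N = 0"
    using norm_mult_self_if_adj_eq[of "N * N"] norm_mult_self_if_adj_eq[OF sN] sN by simp
  thus ?thesis using a PN(1) by (simp add: cstar_pos_scaleR)
qed

lemma cstar_pos_conj: "cstar_pos a \<Longrightarrow> cstar_pos (adj c * a * (c::'a::unital_cstar_algebra))"
proof -
  assume "cstar_pos a"
  then obtain b where b: "cstar_pos b" "b * b = a" by (rule cstar_pos_sqrt)
  hence "adj c * a * c = adj c * (b * b) * c" by simp
  also have "\<dots> = adj (b * c) * (b * c)" using cstar_pos_adj[OF b(1)] by (simp add: mult.assoc)
  finally have "adj c * a * c = adj (b * c) * (b * c)" .
  thus ?thesis using cstar_pos_adj_mult_self[of "b * c"] by simp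
qed

section \<open>Square matrices over a C*-algebra\<close>

text \<open>A \<open>k \<times> k\<close> matrix is a function \<open>nat \<Rightarrow> nat \<Rightarrow> 'a\<close> of which only the entries below \<open>k\<close>
  matter; \<open>vec_inner\<close> is the \<open>'a\<close>-valued inner product of the Hilbert module \<open>'a\<^sup>k\<close>.\<close>

definition vec_inner :: "nat \<Rightarrow> (nat \<Rightarrow> 'a) \<Rightarrow> (nat \<Rightarrow> 'a) \<Rightarrow> 'a::cstar_algebra" where
  "vec_inner k \<xi> \<eta> = (\<Sum>p<k. adj (\<xi> p) * \<eta> p)"

definition mat_vec :: "nat \<Rightarrow> (nat \<Rightarrow> nat \<Rightarrow> 'a) \<Rightarrow> (nat \<Rightarrow> 'a) \<Rightarrow> nat \<Rightarrow> 'a::semiring_0" where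
  "mat_vec k M \<xi> p = (\<Sum>q<k. M p q * \<xi> q)"

definition mat_mult ::
  "nat \<Rightarrow> (nat \<Rightarrow> nat \<Rightarrow> 'a) \<Rightarrow> (nat \<Rightarrow> nat \<Rightarrow> 'a) \<Rightarrow> nat \<Rightarrow> nat \<Rightarrow> 'a::semiring_0" where
  "mat_mult k A B p q = (\<Sum>l<k. A p l * B l q)"

definition mat_id :: "nat \<Rightarrow> nat \<Rightarrow> 'a::{zero,one}" where
  "mat_id p q = (if p = q then 1 else 0)"

primrec mat_power :: "nat \<Rightarrow> (nat \<Rightarrow> nat \<Rightarrow> 'a) \<Rightarrow> nat \<Rightarrow> nat \<Rightarrow> nat \<Rightarrow> 'a::ring_1" where
  "mat_power k C 0 = mat_id"
| "mat_power k C (Suc n) = mat_mult k C (mat_power k C n)"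

definition mat_hermitian :: "nat \<Rightarrow> (nat \<Rightarrow> nat \<Rightarrow> 'a::cstar_algebra) \<Rightarrow> bool" where
  "mat_hermitian k C \<longleftrightarrow> (\<forall>p<k. \<forall>q<k. adj (C p q) = C q p)"

definition mat_contraction :: "nat \<Rightarrow> (nat \<Rightarrow> nat \<Rightarrow> 'a::unital_cstar_algebra) \<Rightarrow> bool" where
  "mat_contraction k C \<longleftrightarrow>
     (\<forall>\<xi>. cstar_le (vec_inner k (mat_vec k C \<xi>) (mat_vec k C \<xi>)) (vec_inner k \<xi> \<xi>))"

lemma mat_mult_assoc: "mat_mult k (mat_mult k A B) D p q = mat_mult k A (mat_mult k B D) p q"
  unfolding mat_mult_def by (simp add: sum_distrib_left sum_distrib_right mult.assoc) (rule sum.swap)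

lemma mat_mult_id_left: "p < k \<Longrightarrow> mat_mult k mat_id X p q = (X p q :: 'a::semiring_1)"
proof -
  have "mat_mult k mat_id X p q = (\<Sum>l<k. if l = p then X p q else 0)"
    unfolding mat_mult_def mat_id_def by (rule sum.cong) auto
  thus "p < k \<Longrightarrow> ?thesis" by simp
qed

lemma mat_mult_id_right: "q < k \<Longrightarrow> mat_mult k X mat_id p q = (X p q :: 'a::semiring_1)"
proof -
  have "mat_mult k X mat_id p q = (\<Sum>l<k. if l = q then X p q else 0)"
    unfolding mat_mult_def mat_id_def by (rule sum.cong) auto
  thus "q < k \<Longrightarrow> ?thesis" by simp
qed

lemma mat_mult_cong:
  "(\<And>l. l < k \<Longrightarrow> B l q = B' l q) \<Longrightarrow> mat_mult k A B p q = mat_mult k A B' p q"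
  unfolding mat_mult_def by (rule sum.cong) auto

lemma mat_mult_mat_power:
  "p < k \<Longrightarrow> q < k \<Longrightarrow> mat_mult k (mat_power k C i) (mat_power k C j) p q = mat_power k C (i + j) p q"
proof (induction i arbitrary: p q)
  case 0 thus ?case by (simp add: mat_mult_id_left)
next
  case (Suc i)
  have "mat_mult k (mat_power k C (Suc i)) (mat_power k C j) p q
      = mat_mult k C (mat_mult k (mat_power k C i) (mat_power k C j)) p q"
    by (simp add: mat_mult_assoc)
  also have "\<dots> = mat_mult k C (mat_power k C (i + j)) p q"
    by (rule mat_mult_cong) (use Suc in auto)
  finally show ?case by simp
qed

lemma mat_power_Suc':
  "p < k \<Longrightarrow> q < k \<Longrightarrow> mat_power k C (Suc n) p q = mat_mult k (mat_power k C n) C p q"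
proof (induction n arbitrary: p q)
  case 0 thus ?case by (simp add: mat_mult_id_left mat_mult_id_right)
next
  case (Suc n)
  have "mat_power k C (Suc (Suc n)) p q = mat_mult k C (mat_mult k (mat_power k C n) C) p q"
    by simp (rule mat_mult_cong, use Suc in auto)
  thus ?case by (simp add: mat_mult_assoc)
qed

lemma adj_mat_power:
  fixes C :: "nat \<Rightarrow> nat \<Rightarrow> 'a::unital_cstar_algebra"
  assumes C: "mat_hermitian k C"
  shows "p < k \<Longrightarrow> q < k \<Longrightarrow> adj (mat_power k C n p q) = mat_power k C n q p"
proof (induction n arbitrary: p q)
  case 0 thus ?case by (simp add: mat_id_def adj_one)
next
  case (Suc n)
  have "adj (mat_power k C (Suc n) p q) = (\<Sum>l<k. adj (mat_power k C n l q) * adj (C p l))"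
    by (simp add: mat_mult_def)
  also have "\<dots> = mat_mult k (mat_power k C n) C q p"
    unfolding mat_mult_def by (rule sum.cong) (use Suc C in \<open>auto simp: mat_hermitian_def\<close>)
  also have "\<dots> = mat_power k C (Suc n) q p" using mat_power_Suc' Suc by metis
  finally show ?case .
qed

lemma cstar_pos_vec_inner_self: "cstar_pos (vec_inner k \<xi> \<xi>)"
  unfolding vec_inner_def by (intro cstar_pos_sum cstar_pos_adj_mult_self)

lemma norm_entry_le_vec_inner:
  fixes \<xi> :: "nat \<Rightarrow> 'a::unital_cstar_algebra"
  assumes "p < k"
  shows "norm (\<xi> p) ^ 2 \<le> norm (vec_inner k \<xi> \<xi>)"
proof -
  have "vec_inner k \<xi> \<xi> - adj (\<xi> p) * \<xi> p = (\<Sum>p'\<in>{..<k} - {p}. adj (\<xi> p') * \<xi> p')"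
    unfolding vec_inner_def using assms by (simp add: sum_diff1)
  hence "cstar_le (adj (\<xi> p) * \<xi> p) (vec_inner k \<xi> \<xi>)"
    by (simp add: cstar_pos_sum cstar_pos_adj_mult_self)
  thus ?thesis
    using norm_le_norm_if_cstar_le[OF cstar_pos_adj_mult_self] by (simp add: norm_adj_mult_self)
qed

text \<open>The columns of the powers of a contraction stay in the unit ball of \<open>'a\<^sup>k\<close>.\<close>

lemma norm_mat_power_le_1:
  fixes C :: "nat \<Rightarrow> nat \<Rightarrow> 'a::unital_cstar_algebra"
  assumes contr: "mat_contraction k C" and "p < k" "j < k"
  shows "norm (mat_power k C n p j) \<le> 1"
proof -
  define v where "v n = (\<lambda>p. mat_power k C n p j)" for n
  have "norm (vec_inner k (v n) (v n)) \<le> 1" for n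
  proof (induction n)
    case 0
    have "vec_inner k (v 0) (v 0) = (\<Sum>p<k. if p = j then 1 else 0)"
      unfolding vec_inner_def v_def mat_power.simps mat_id_def by (rule sum.cong) (auto simp: adj_one)
    thus ?case using assms(3) by simp
  next
    case (Suc n)
    have "v (Suc n) = mat_vec k C (v n)" unfolding v_def by (auto simp: mat_vec_def mat_mult_def)
    hence "cstar_le (vec_inner k (v (Suc n)) (v (Suc n))) (vec_inner k (v n) (v n))"
      using contr by (simp add: mat_contraction_def)
    hence "norm (vec_inner k (v (Suc n)) (v (Suc n))) \<le> norm (vec_inner k (v n) (v n))"
      by (rule norm_le_norm_if_cstar_le[OF cstar_pos_vec_inner_self])
    thus ?case using Suc by simp
  qed
  hence "norm (v n p) ^ 2 \<le> 1" using norm_entry_le_vec_inner[OF assms(2), of "v n"] by (meson order_trans)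
  thus ?thesis unfolding v_def by (simp add: power_le_one_iff)
qed

definition mat_sqrt_one_minus ::
  "nat \<Rightarrow> (nat \<Rightarrow> nat \<Rightarrow> 'a::unital_cstar_algebra) \<Rightarrow> nat \<Rightarrow> nat \<Rightarrow> 'a" where
  "mat_sqrt_one_minus k C p q = (\<Sum>n. sqrt_coeff n *\<^sub>R mat_power k C n p q)"

lemma summable_norm_mat_sqrt_series:
  assumes "mat_contraction k C" "p < k" "q < k"
  shows "summable (\<lambda>n. norm (sqrt_coeff n *\<^sub>R mat_power k C n p q))"
  using norm_mat_power_le_1[OF assms]
  by (intro summable_comparison_test[OF _ summable_abs_sqrt_coeff]) (auto simp: mult_left_le)

lemma adj_mat_sqrt_one_minus:
  assumes "mat_contraction k C" "mat_hermitian k C" "p < k" "q < k"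
  shows "adj (mat_sqrt_one_minus k C p q) = mat_sqrt_one_minus k C q p"
  unfolding mat_sqrt_one_minus_def
  using bounded_linear.suminf[OF bounded_linear_adj
      summable_norm_cancel[OF summable_norm_mat_sqrt_series[OF assms(1,3,4)]]]
  by (simp add: adj_mat_power[OF assms(2,3,4)])

lemma mat_sqrt_one_minus_square:
  assumes contr: "mat_contraction k C" and pq: "p < k" "q < k"
  shows "mat_mult k (mat_sqrt_one_minus k C) (mat_sqrt_one_minus k C) p q = mat_id p q - C p q"
proof -
  define f where "f p q n = sqrt_coeff n *\<^sub>R mat_power k C n p q" for p q n
  note sn = summable_norm_mat_sqrt_series[OF contr, folded f_def]
  define g where "g l N = (\<Sum>i\<le>N. f p l i * f l q (N - i))" for l N
  have "mat_mult k (mat_sqrt_one_minus k C) (mat_sqrt_one_minus k C) p q = (\<Sum>l<k. \<Sum>N. g l N)"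
    unfolding mat_mult_def mat_sqrt_one_minus_def f_def[symmetric] g_def
    by (intro sum.cong refl Cauchy_product sn) (auto simp: pq)
  also have "\<dots> = (\<Sum>N. \<Sum>l<k. g l N)"
    unfolding g_def using pq
    by (intro suminf_sum[symmetric] summable_Cauchy_product sn) auto
  also have "\<dots> = (\<Sum>N. (\<Sum>i\<le>N. sqrt_coeff i * sqrt_coeff (N - i)) *\<^sub>R mat_power k C N p q)"
  proof (rule suminf_cong)
    fix N
    have "(\<Sum>l<k. g l N) = (\<Sum>i\<le>N. (sqrt_coeff i * sqrt_coeff (N - i)) *\<^sub>R
        mat_mult k (mat_power k C i) (mat_power k C (N - i)) p q)"
      unfolding g_def f_def mat_mult_def
      by (simp add: scaleR_sum_right sum.swap[of _ "{..<k}"] mult.assoc) (simp add: mult.commute)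
    thus "(\<Sum>l<k. g l N) = (\<Sum>i\<le>N. sqrt_coeff i * sqrt_coeff (N - i)) *\<^sub>R mat_power k C N p q"
      by (simp add: mat_mult_mat_power[OF pq] scaleR_sum_left)
  qed
  also have "\<dots> = (\<Sum>N. if N = 0 then mat_power k C 0 p q else if N = 1 then - mat_power k C 1 p q else 0)"
    by (rule suminf_cong) (simp add: sqrt_coeff_convolution)
  also have "\<dots> = (\<Sum>N\<in>{0::nat,1}. if N = 0 then mat_power k C 0 p q else if N = 1 then - mat_power k C 1 p q else 0)"
    by (rule suminf_finite) auto
  finally show ?thesis using mat_mult_id_right[OF pq(2), of C p] by simp
qed

lemma vec_inner_adj: "adj (vec_inner k \<xi> \<eta>) = vec_inner k \<eta> (\<xi> :: nat \<Rightarrow> 'a::cstar_algebra)"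
  unfolding vec_inner_def by simp

lemma vec_inner_cong:
  "(\<And>p. p < k \<Longrightarrow> \<xi> p = \<xi>' p) \<Longrightarrow> (\<And>p. p < k \<Longrightarrow> \<eta> p = \<eta>' p) \<Longrightarrow> vec_inner k \<xi> \<eta> = vec_inner k \<xi>' \<eta>'"
  unfolding vec_inner_def by (rule sum.cong) auto

lemma vec_inner_diff_scaleR:
  fixes \<xi> \<zeta> :: "nat \<Rightarrow> 'a::unital_cstar_algebra"
  shows "vec_inner k (\<lambda>p. \<xi> p - s *\<^sub>R \<zeta> p) (\<lambda>p. \<xi> p - s *\<^sub>R \<zeta> p)
     = vec_inner k \<xi> \<xi> - s *\<^sub>R vec_inner k \<xi> \<zeta> - s *\<^sub>R vec_inner k \<zeta> \<xi> + (s * s) *\<^sub>R vec_inner k \<zeta> \<zeta>"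
proof -
  have "vec_inner k (\<lambda>p. \<xi> p - s *\<^sub>R \<zeta> p) (\<lambda>p. \<xi> p - s *\<^sub>R \<zeta> p)
      = (\<Sum>p<k. adj (\<xi> p) * \<xi> p - s *\<^sub>R (adj (\<xi> p) * \<zeta> p) - s *\<^sub>R (adj (\<zeta> p) * \<xi> p)
               + (s * s) *\<^sub>R (adj (\<zeta> p) * \<zeta> p))"
    unfolding vec_inner_def by (rule sum.cong) (auto simp: algebra_simps)
  thus ?thesis unfolding vec_inner_def by (simp only: sum.distrib sum_subtractf scaleR_sum_right)
qed

lemma mat_vec_id_minus:
  "p < k \<Longrightarrow> mat_vec k (\<lambda>p q. mat_id p q - s *\<^sub>R P p q) \<xi> p = \<xi> p - s *\<^sub>R mat_vec k P \<xi> p"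
  for P :: "nat \<Rightarrow> nat \<Rightarrow> 'a::real_algebra_1"
proof -
  assume "p < k"
  have "(\<Sum>q<k. mat_id p q * \<xi> q) = (\<Sum>q<k. if q = p then \<xi> p else 0)"
    unfolding mat_id_def by (rule sum.cong) auto
  thus ?thesis using \<open>p < k\<close> unfolding mat_vec_def
    by (simp add: left_diff_distrib sum_subtractf scaleR_sum_right)
qed

text \<open>\<open>\<langle>\<xi>, \<xi>\<rangle> - \<langle>C\<xi>, C\<xi>\<rangle> = (2/t) \<langle>\<xi>, P\<xi>\<rangle> - \<langle>P\<xi>, P\<xi>\<rangle> / t\<^sup>2 \<ge> ((2t - c) / t\<^sup>2) \<langle>\<xi>, P\<xi>\<rangle>\<close>
  for \<open>C = 1 - P / t\<close>.\<close>

lemma mat_contraction_one_minus_scaled: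
  fixes P :: "nat \<Rightarrow> nat \<Rightarrow> 'a::unital_cstar_algebra"
  assumes pos: "\<And>\<xi>. cstar_pos (vec_inner k \<xi> (mat_vec k P \<xi>))"
    and bound: "\<And>\<xi>. cstar_le (vec_inner k (mat_vec k P \<xi>) (mat_vec k P \<xi>)) (c *\<^sub>R vec_inner k \<xi> (mat_vec k P \<xi>))"
    and t: "t > 0" "c \<le> 2 * t"
  shows "mat_contraction k (\<lambda>p q. mat_id p q - (1 / t) *\<^sub>R P p q)"
  unfolding mat_contraction_def
proof
  fix \<xi> :: "nat \<Rightarrow> 'a"
  define s where "s = 1 / t"
  define \<zeta> where "\<zeta> = mat_vec k P \<xi>"
  define G where "G = vec_inner k \<xi> \<zeta>"
  have G: "cstar_pos G" "vec_inner k \<zeta> \<xi> = G"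
    using pos[of \<xi>] cstar_pos_adj[OF pos[of \<xi>]] vec_inner_adj[of k \<xi> \<zeta>] by (simp_all add: G_def \<zeta>_def)
  have "mat_vec k (\<lambda>p q. mat_id p q - s *\<^sub>R P p q) \<xi> p = \<xi> p - s *\<^sub>R \<zeta> p" if "p < k" for p
    unfolding \<zeta>_def using that by (rule mat_vec_id_minus)
  hence "vec_inner k (mat_vec k (\<lambda>p q. mat_id p q - s *\<^sub>R P p q) \<xi>)
                     (mat_vec k (\<lambda>p q. mat_id p q - s *\<^sub>R P p q) \<xi>)
      = vec_inner k (\<lambda>p. \<xi> p - s *\<^sub>R \<zeta> p) (\<lambda>p. \<xi> p - s *\<^sub>R \<zeta> p)"
    by (intro vec_inner_cong) auto
  also have "\<dots> = vec_inner k \<xi> \<xi> - (s + s) *\<^sub>R G + (s * s) *\<^sub>R vec_inner k \<zeta> \<zeta>"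
    by (simp only: vec_inner_diff_scaleR G(2) G_def[symmetric] scaleR_add_left) simp
  also have "(s + s) *\<^sub>R G = (s * s) *\<^sub>R ((2 * t - c) *\<^sub>R G + c *\<^sub>R G)"
  proof -
    have "(2 * t - c) *\<^sub>R G + c *\<^sub>R G = (2 * t) *\<^sub>R G" by (metis diff_add_cancel scaleR_left_distrib)
    moreover have "s * s * (2 * t) = s + s" using t by (simp add: s_def)
    ultimately show ?thesis by simp
  qed
  finally have "vec_inner k \<xi> \<xi> - vec_inner k (mat_vec k (\<lambda>p q. mat_id p q - s *\<^sub>R P p q) \<xi>)
                                       (mat_vec k (\<lambda>p q. mat_id p q - s *\<^sub>R P p q) \<xi>)
      = (s * s) *\<^sub>R ((2 * t - c) *\<^sub>R G + (c *\<^sub>R G - vec_inner k \<zeta> \<zeta>))"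
    by (simp add: algebra_simps)
  moreover have "cstar_pos ((s * s) *\<^sub>R ((2 * t - c) *\<^sub>R G + (c *\<^sub>R G - vec_inner k \<zeta> \<zeta>)))"
    using t G(1) bound[of \<xi>] by (intro cstar_pos_scaleR cstar_pos_add) (auto simp: \<zeta>_def G_def)
  ultimately show "cstar_le (vec_inner k (mat_vec k (\<lambda>p q. mat_id p q - (1 / t) *\<^sub>R P p q) \<xi>)
                          (mat_vec k (\<lambda>p q. mat_id p q - (1 / t) *\<^sub>R P p q) \<xi>)) (vec_inner k \<xi> \<xi>)"
    by (simp add: s_def)
qed

lemma cstar_le_adj_sum_mult_sum:
  fixes z :: "'i \<Rightarrow> 'a::unital_cstar_algebra"
  assumes "finite I"
  shows "cstar_le (adj (\<Sum>x\<in>I. z x) * (\<Sum>x\<in>I. z x)) (real (card I) *\<^sub>R (\<Sum>x\<in>I. adj (z x) * z x))"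
proof -
  define S where "S = (\<Sum>x\<in>I. adj (z x) * z x)"
  define D where "D = (\<Sum>x\<in>I. \<Sum>x'\<in>I. adj (z x - z x') * (z x - z x'))"
  have "D = (\<Sum>x\<in>I. \<Sum>x'\<in>I. adj (z x) * z x) + (\<Sum>x\<in>I. \<Sum>x'\<in>I. adj (z x') * z x')
      - (\<Sum>x\<in>I. \<Sum>x'\<in>I. adj (z x) * z x') - (\<Sum>x\<in>I. \<Sum>x'\<in>I. adj (z x') * z x)"
    unfolding D_def by (simp add: algebra_simps sum.distrib sum_subtractf)
  also have "(\<Sum>x\<in>I. \<Sum>x'\<in>I. adj (z x) * z x) = real (card I) *\<^sub>R S"
    by (simp only: sum_constant_scaleR) (simp add: S_def scaleR_sum_right)
  also have "(\<Sum>x\<in>I. \<Sum>x'\<in>I. adj (z x') * z x') = real (card I) *\<^sub>R S"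
    by (simp only: sum_constant_scaleR) (simp add: S_def)
  also have "(\<Sum>x\<in>I. \<Sum>x'\<in>I. adj (z x) * z x') = adj (\<Sum>x\<in>I. z x) * (\<Sum>x\<in>I. z x)"
    by (simp add: sum_distrib_left sum_distrib_right) (subst sum.swap, rule refl)
  also have "(\<Sum>x\<in>I. \<Sum>x'\<in>I. adj (z x') * z x) = adj (\<Sum>x\<in>I. z x) * (\<Sum>x\<in>I. z x)"
    by (simp add: sum_distrib_left sum_distrib_right)
  finally have "D = (real (card I) *\<^sub>R S - adj (\<Sum>x\<in>I. z x) * (\<Sum>x\<in>I. z x))
                 + (real (card I) *\<^sub>R S - adj (\<Sum>x\<in>I. z x) * (\<Sum>x\<in>I. z x))"
    by (simp add: algebra_simps)
  hence "real (card I) *\<^sub>R S - adj (\<Sum>x\<in>I. z x) * (\<Sum>x\<in>I. z x) = (1/2) *\<^sub>R D"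
    by (simp only: scaleR_2[symmetric]) simp
  moreover have "cstar_pos D" unfolding D_def by (intro cstar_pos_sum cstar_pos_adj_mult_self)
  ultimately show ?thesis unfolding S_def by (simp add: cstar_pos_scaleR)
qed

lemma cstar_le_adj_mult_left:
  fixes a e :: "'a::unital_cstar_algebra"
  assumes "norm a \<le> K"
  shows "cstar_le (adj (a * e) * (a * e)) ((K ^ 2) *\<^sub>R (adj e * e))"
proof -
  have "norm (adj a * a) \<le> K ^ 2" using assms by (simp add: norm_adj_mult_self power_mono)
  hence "cstar_pos (of_real (norm (adj a * a)) - adj a * a + of_real (K ^ 2 - norm (adj a * a)))"
    by (intro cstar_pos_add cstar_pos_norm_minus cstar_pos_of_real) auto
  hence "cstar_pos (adj e * (of_real (K ^ 2) - adj a * a) * e)"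
    by (intro cstar_pos_conj) (simp add: of_real_diff)
  moreover have "adj e * (of_real (K ^ 2) - adj a * a) * e = (K ^ 2) *\<^sub>R (adj e * e) - adj (a * e) * (a * e)"
    by (simp add: algebra_simps of_real_def)
  ultimately show ?thesis by simp
qed

lemma vec_inner_mat_vec_le:
  fixes a :: "nat \<Rightarrow> 'i \<Rightarrow> 'a::unital_cstar_algebra" and \<eta> :: "'i \<Rightarrow> 'a"
  assumes fin: "finite I" and bound: "\<And>p x. p < k \<Longrightarrow> x \<in> I \<Longrightarrow> norm (a p x) \<le> K"
  shows "cstar_le (vec_inner k (\<lambda>p. \<Sum>x\<in>I. a p x * \<eta> x) (\<lambda>p. \<Sum>x\<in>I. a p x * \<eta> x))
                  ((real k * real (card I) * K ^ 2) *\<^sub>R (\<Sum>x\<in>I. adj (\<eta> x) * \<eta> x))"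
proof -
  have "cstar_le (adj (\<Sum>x\<in>I. a p x * \<eta> x) * (\<Sum>x\<in>I. a p x * \<eta> x))
                 ((real (card I) * K ^ 2) *\<^sub>R (\<Sum>x\<in>I. adj (\<eta> x) * \<eta> x))" if "p < k" for p
  proof (rule cstar_le_trans[OF cstar_le_adj_sum_mult_sum[OF fin]])
    have "cstar_le (\<Sum>x\<in>I. adj (a p x * \<eta> x) * (a p x * \<eta> x)) (\<Sum>x\<in>I. (K ^ 2) *\<^sub>R (adj (\<eta> x) * \<eta> x))"
      using bound that by (intro cstar_le_sum cstar_le_adj_mult_left) auto
    hence "cstar_le (real (card I) *\<^sub>R (\<Sum>x\<in>I. adj (a p x * \<eta> x) * (a p x * \<eta> x)))
                    (real (card I) *\<^sub>R (\<Sum>x\<in>I. (K ^ 2) *\<^sub>R (adj (\<eta> x) * \<eta> x)))"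
      by (rule cstar_le_scaleR[rotated]) simp
    thus "cstar_le (real (card I) *\<^sub>R (\<Sum>x\<in>I. adj (a p x * \<eta> x) * (a p x * \<eta> x)))
                   ((real (card I) * K ^ 2) *\<^sub>R (\<Sum>x\<in>I. adj (\<eta> x) * \<eta> x))"
      by (simp only: scaleR_sum_right[symmetric] scaleR_scaleR)
  qed
  hence "cstar_le (vec_inner k (\<lambda>p. \<Sum>x\<in>I. a p x * \<eta> x) (\<lambda>p. \<Sum>x\<in>I. a p x * \<eta> x))
           (\<Sum>p<k. (real (card I) * K ^ 2) *\<^sub>R (\<Sum>x\<in>I. adj (\<eta> x) * \<eta> x))"
    unfolding vec_inner_def by (intro cstar_le_sum) auto
  thus ?thesis by (simp only: sum_constant_scaleR card_lessThan scaleR_scaleR mult.assoc)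
qed

text \<open>Since \<open>\<surd>(1 - C)\<close> is hermitian, \<open>B = \<surd>t \<surd>(1 - C)\<close> with \<open>C = 1 - P / t\<close> gives \<open>B\<^sup>* B = P\<close>.\<close>

lemma mat_pos_if_bounded:
  fixes P :: "nat \<Rightarrow> nat \<Rightarrow> 'a::unital_cstar_algebra"
  assumes herm: "mat_hermitian k P" and c: "c \<ge> 0"
    and pos: "\<And>\<xi>. cstar_pos (vec_inner k \<xi> (mat_vec k P \<xi>))"
    and bound: "\<And>\<xi>. cstar_le (vec_inner k (mat_vec k P \<xi>) (mat_vec k P \<xi>)) (c *\<^sub>R vec_inner k \<xi> (mat_vec k P \<xi>))"
  shows "mat_pos (*) adj k P"
proof -
  define t where "t = c / 2 + 1"
  have t: "t > 0" "c \<le> 2 * t" using c by (simp_all add: t_def)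
  define C where "C p q = mat_id p q - (1 / t) *\<^sub>R P p q" for p q
  have contr: "mat_contraction k C"
    unfolding C_def by (rule mat_contraction_one_minus_scaled[OF pos bound t])
  have "mat_hermitian k C" using herm by (simp add: mat_hermitian_def C_def mat_id_def adj_one)
  define S where "S = mat_sqrt_one_minus k C"
  have "(\<Sum>l<k. adj (sqrt t *\<^sub>R S l p) * (sqrt t *\<^sub>R S l q)) = P p q" if pq: "p < k" "q < k" for p q
  proof -
    have "(\<Sum>l<k. adj (sqrt t *\<^sub>R S l p) * (sqrt t *\<^sub>R S l q)) = t *\<^sub>R mat_mult k S S p q"
      unfolding mat_mult_def scaleR_sum_right S_def
      using adj_mat_sqrt_one_minus[OF contr \<open>mat_hermitian k C\<close> _ pq(1)] t by (intro sum.cong) auto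
    also have "\<dots> = P p q" using mat_sqrt_one_minus_square[OF contr pq] t by (simp add: S_def C_def)
    finally show ?thesis .
  qed
  thus ?thesis unfolding mat_pos_def by (intro exI[where x="\<lambda>l p. sqrt t *\<^sub>R S l p"]) auto
qed

text \<open>\<open>\<langle>\<xi>, P\<xi>\<rangle> = \<Sum>\<^sub>x \<eta>\<^sub>x\<^sup>* \<eta>\<^sub>x\<close> with \<open>\<eta>\<^sub>x = \<Sum>\<^sub>q y\<^sub>x\<^sub>q \<xi>\<^sub>q\<close>, and any bound \<open>K\<close> on the entries \<open>y\<^sub>x\<^sub>p\<close> gives
  the crude estimate \<open>\<langle>P\<xi>, P\<xi>\<rangle> \<le> k |I| K\<^sup>2 \<langle>\<xi>, P\<xi>\<rangle>\<close>.\<close>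

lemma mat_pos_gram:
  fixes y :: "'i \<Rightarrow> nat \<Rightarrow> 'a::unital_cstar_algebra"
  assumes fin: "finite I"
  shows "mat_pos (*) adj k (\<lambda>p q. \<Sum>x\<in>I. adj (y x p) * y x q)"
proof -
  define P where "P p q = (\<Sum>x\<in>I. adj (y x p) * y x q)" for p q
  define K where "K = (\<Sum>x\<in>I. \<Sum>p<k. norm (y x p))"
  have K: "norm (adj (y x p)) \<le> K" if "p < k" "x \<in> I" for p x
  proof -
    have "norm (y x p) \<le> (\<Sum>p'<k. norm (y x p'))" by (rule member_le_sum) (use that in auto)
    also have "\<dots> \<le> K" unfolding K_def
      by (rule member_le_sum[of x I "\<lambda>x. \<Sum>p<k. norm (y x p)"]) (use that fin in \<open>auto intro: sum_nonneg\<close>)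
    finally show ?thesis by simp
  qed
  have "mat_pos (*) adj k P"
  proof (rule mat_pos_if_bounded[where c="real k * real (card I) * K ^ 2"])
    show "mat_hermitian k P" by (simp add: mat_hermitian_def P_def)
    show "0 \<le> real k * real (card I) * K ^ 2" by simp
    fix \<xi> :: "nat \<Rightarrow> 'a"
    define \<eta> where "\<eta> x = (\<Sum>q<k. y x q * \<xi> q)" for x
    have P\<xi>: "mat_vec k P \<xi> = (\<lambda>p. \<Sum>x\<in>I. adj (y x p) * \<eta> x)"
      unfolding mat_vec_def P_def \<eta>_def
      by (simp add: sum_distrib_left sum_distrib_right mult.assoc) (subst sum.swap, rule refl)
    have G: "vec_inner k \<xi> (mat_vec k P \<xi>) = (\<Sum>x\<in>I. adj (\<eta> x) * \<eta> x)"
      unfolding P\<xi> vec_inner_def \<eta>_def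
      by (simp add: sum_distrib_left sum_distrib_right mult.assoc)
         (subst sum.swap, rule sum.cong[OF refl], rule sum.swap)
    show "cstar_pos (vec_inner k \<xi> (mat_vec k P \<xi>))"
      unfolding G by (intro cstar_pos_sum cstar_pos_adj_mult_self)
    show "cstar_le (vec_inner k (mat_vec k P \<xi>) (mat_vec k P \<xi>))
        ((real k * real (card I) * K ^ 2) *\<^sub>R vec_inner k \<xi> (mat_vec k P \<xi>))"
      unfolding G unfolding P\<xi> by (rule vec_inner_mat_vec_le[OF fin K])
  qed
  thus ?thesis unfolding P_def .
qed

section \<open>Block matrices\<close>

text \<open>An \<open>n \<times> n\<close> block of a \<open>k n \<times> k n\<close> matrix: the index \<open>blk l r\<close> addresses coordinate
  \<open>r\<close> of the \<open>l\<close>-th block, through a fixed enumeration of the finite index type.\<close>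

definition enum_index :: "'n::finite \<Rightarrow> nat" where
  "enum_index = (SOME f. bij_betw f UNIV {..<CARD('n)})"

definition blk :: "nat \<Rightarrow> 'n::finite \<Rightarrow> nat" where
  "blk l r = l * CARD('n) + enum_index r"

definition blk_coord :: "nat \<Rightarrow> 'n::finite" where
  "blk_coord s = inv_into UNIV enum_index (s mod CARD('n))"

lemma bij_enum_index: "bij_betw (enum_index :: 'n::finite \<Rightarrow> nat) UNIV {..<CARD('n)}"
proof -
  have "\<exists>f :: 'n \<Rightarrow> nat. bij_betw f UNIV {..<CARD('n)}"
    using ex_bij_betw_finite_nat[of "UNIV :: 'n set"] by (auto simp: atLeast0LessThan)
  thus ?thesis unfolding enum_index_def by (rule someI_ex)
qed

lemma enum_index_less: "enum_index (r::'n::finite) < CARD('n)"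
  using bij_betwE[OF bij_enum_index] by blast

lemma blk_div [simp]: "blk l (r::'n::finite) div CARD('n) = l"
  using enum_index_less[of r] by (simp add: blk_def)

lemma blk_coord_blk [simp]: "blk_coord (blk l r) = (r::'n::finite)"
  using enum_index_less[of r] inv_f_f[OF bij_betw_imp_inj_on[OF bij_enum_index[where 'n='n]]]
  by (simp add: blk_def blk_coord_def)

lemma blk_less: "l < k \<Longrightarrow> blk l (r::'n::finite) < k * CARD('n)"
proof -
  assume "l < k"
  hence "Suc l * CARD('n) \<le> k * CARD('n)" by (intro mult_right_mono) auto
  thus ?thesis using enum_index_less[of r] by (simp add: blk_def)
qed

lemma blk_div_coord: "blk (s div CARD('n)) (blk_coord s :: 'n::finite) = s"
proof -
  have "s mod CARD('n) \<in> (enum_index :: 'n \<Rightarrow> nat) ` UNIV"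
    unfolding bij_betw_imp_surj_on[OF bij_enum_index[where 'n='n]] by (simp add: finite_UNIV_card_ge_0)
  hence "enum_index (blk_coord s :: 'n) = s mod CARD('n)"
    unfolding blk_coord_def by (rule f_inv_into_f)
  thus ?thesis by (simp add: blk_def)
qed

lemma sum_blk: "(\<Sum>s<k * CARD('n::finite). f s) = (\<Sum>l<k. \<Sum>r\<in>(UNIV :: 'n set). f (blk l r))"
proof -
  have "bij_betw (\<lambda>(l, r). blk l r) ({..<k} \<times> (UNIV :: 'n set)) {..<k * CARD('n)}"
    by (rule bij_betwI[where g="\<lambda>s. (s div CARD('n), blk_coord s)"])
       (auto simp: blk_less blk_div_coord less_mult_imp_div_less)
  thus ?thesis by (simp add: sum.cartesian_product sum.reindex_bij_betw[symmetric] case_prod_beta)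
qed

definition matrix_unit :: "'n \<Rightarrow> 'n \<Rightarrow> 'a::zero \<Rightarrow> 'a^'n^'n" where
  "matrix_unit i j a = (\<chi> r c. if r = i \<and> c = j then a else 0)"

lemma matrix_unit_nth [simp]: "matrix_unit i j a $ r $ c = (if r = i \<and> c = j then a else 0)"
  by (simp add: matrix_unit_def)

lemma matrix_unit_add: "matrix_unit i j (a + b) = matrix_unit i j a + matrix_unit i j (b::'a::monoid_add)"
  by (simp add: vec_eq_iff)

lemma matrix_unit_sum:
  "finite A \<Longrightarrow> matrix_unit i j (sum f A) = (\<Sum>x\<in>A. matrix_unit i j (f x :: 'a::comm_monoid_add))"
  by (induction A rule: finite_induct) (simp_all add: matrix_unit_add vec_eq_iff)

lemma madj_matrix_unit: "madj (matrix_unit i j x) = matrix_unit j i (adj (x::'a::cstar_algebra))"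
  by (simp add: vec_eq_iff madj_def)

lemma matrix_unit_mult: "matrix_unit i l x ** matrix_unit l j y = matrix_unit i j (x * (y::'a::semiring_1))"
proof -
  have "(\<Sum>m\<in>UNIV. (if r = i \<and> m = l then x else 0) * (if m = l \<and> c = j then y else 0))
      = (\<Sum>m\<in>UNIV. if m = l then (if r = i \<and> c = j then x * y else 0) else 0)" for r c
    by (rule sum.cong) auto
  thus ?thesis by (simp add: vec_eq_iff matrix_matrix_mult_def)
qed

lemma sum_matrix_units: "(\<Sum>i\<in>UNIV. \<Sum>j\<in>UNIV. matrix_unit i j (X $ i $ j)) = (X :: 'a::comm_monoid_add^'n::finite^'n)"
proof -
  have "(\<Sum>i\<in>UNIV. \<Sum>j\<in>UNIV. if r = i \<and> c = j then X $ i $ j else 0)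
      = (\<Sum>i\<in>UNIV. if i = r then X $ r $ c else 0)" for r c
    by (rule sum.cong[OF refl]) auto
  thus ?thesis by (simp add: vec_eq_iff)
qed

lemma madj_mult_nth: "(madj X ** Y) $ i $ j = (\<Sum>r\<in>UNIV. adj (X $ r $ i) * Y $ r $ j)"
  for X Y :: "'a::unital_cstar_algebra^'n::finite^'n"
  by (simp add: matrix_matrix_mult_def madj_def)

lemma hat_matrix_unit:
  fixes \<phi> :: "'a::zero \<Rightarrow> 'u::comm_monoid_add^'n::finite^'n"
  assumes "\<phi> 0 = 0"
  shows "hat \<phi> (matrix_unit i j a) = \<phi> a $ i $ j"
proof -
  have "\<phi> (matrix_unit i j a $ r $ c) $ r $ c = (if r = i then if c = j then \<phi> a $ i $ j else 0 else 0)"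
    for r c
    by (auto simp: assms)
  hence "hat \<phi> (matrix_unit i j a)
      = (\<Sum>r\<in>UNIV. \<Sum>c\<in>UNIV. if r = i then if c = j then \<phi> a $ i $ j else 0 else 0)"
    unfolding hat_def by (simp only:)
  also have "\<dots> = (\<Sum>r\<in>UNIV. if r = i then (\<Sum>c\<in>UNIV. if c = j then \<phi> a $ i $ j else 0) else 0)"
    by (rule sum.cong) auto
  finally show ?thesis by simp
qed

definition block_entries :: "(nat \<Rightarrow> nat \<Rightarrow> 'a^'n::finite^'n) \<Rightarrow> nat \<Rightarrow> nat \<Rightarrow> 'a" where
  "block_entries M s s' = M (s div CARD('n)) (s' div CARD('n)) $ blk_coord s $ blk_coord s'"

definition block_units :: "(nat \<Rightarrow> nat \<Rightarrow> 'a::zero) \<Rightarrow> nat \<Rightarrow> nat \<Rightarrow> 'a^'n::finite^'n" where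
  "block_units M s s' = matrix_unit (blk_coord s) (blk_coord s') (M (s div CARD('n)) (s' div CARD('n)))"

lemma mat_pos_cong:
  "(\<And>i j. i < k \<Longrightarrow> j < k \<Longrightarrow> M i j = M' i j) \<Longrightarrow> mat_pos mul ad k M \<longleftrightarrow> mat_pos mul ad k M'"
  unfolding mat_pos_def by auto

lemma mat_pos_block_entries:
  fixes M :: "nat \<Rightarrow> nat \<Rightarrow> 'a::unital_cstar_algebra^'n::finite^'n"
  assumes "mat_pos (**) madj k M"
  shows "mat_pos (*) adj (k * CARD('n)) (block_entries M)"
proof -
  obtain B where B: "\<And>i j. i < k \<Longrightarrow> j < k \<Longrightarrow> M i j = (\<Sum>l<k. madj (B l i) ** B l j)"
    using assms unfolding mat_pos_def by blast
  define B' where "B' m s = B (m div CARD('n)) (s div CARD('n)) $ blk_coord m $ blk_coord s" for m s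
  have "block_entries M s s' = (\<Sum>m<k * CARD('n). adj (B' m s) * B' m s')"
    if "s < k * CARD('n)" "s' < k * CARD('n)" for s s'
  proof -
    have "block_entries M s s' = (\<Sum>l<k. \<Sum>r\<in>UNIV.
        adj (B l (s div CARD('n)) $ r $ blk_coord s) * B l (s' div CARD('n)) $ r $ blk_coord s')"
      unfolding block_entries_def using that
      by (simp add: B less_mult_imp_div_less madj_mult_nth)
    also have "\<dots> = (\<Sum>m<k * CARD('n). adj (B' m s) * B' m s')"
      unfolding sum_blk B'_def by simp
    finally show ?thesis .
  qed
  thus ?thesis unfolding mat_pos_def by blast
qed

text \<open>The factor puts \<open>b\<^sub>l\<^sub>p\<close> into row \<open>i\<^sub>0\<close> of the matrix unit at column \<open>i\<close>, using only the
  first \<open>k\<close> of the \<open>k n\<close> available rows, since \<open>E\<^sub>i\<^sub>0\<^sub>i\<^sup>* E\<^sub>i\<^sub>0\<^sub>j = E\<^sub>i\<^sub>j\<close>.\<close>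

lemma mat_pos_block_units:
  fixes M :: "nat \<Rightarrow> nat \<Rightarrow> 'a::unital_cstar_algebra"
  assumes "mat_pos (*) adj k M"
  shows "mat_pos (**) madj (k * CARD('n)) (block_units M :: nat \<Rightarrow> nat \<Rightarrow> 'a^'n::finite^'n)"
proof -
  obtain b where b: "\<And>i j. i < k \<Longrightarrow> j < k \<Longrightarrow> M i j = (\<Sum>l<k. adj (b l i) * b l j)"
    using assms unfolding mat_pos_def by blast
  fix i0 :: 'n
  define B where "B m s = (if m < k then matrix_unit i0 (blk_coord s) (b m (s div CARD('n))) else 0)"
    for m s
  have "block_units M s s' = (\<Sum>m<k * CARD('n). madj (B m s) ** B m s')"
    if "s < k * CARD('n)" "s' < k * CARD('n)" for s s'
  proof -
    have "(\<Sum>m<k * CARD('n). madj (B m s) ** B m s') = (\<Sum>m<k. madj (B m s) ** B m s')"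
      by (rule sum.mono_neutral_right) (auto simp: B_def finite_UNIV_card_ge_0)
    also have "\<dots> = (\<Sum>m<k. matrix_unit (blk_coord s) (blk_coord s')
                              (adj (b m (s div CARD('n))) * b m (s' div CARD('n))))"
      by (rule sum.cong) (auto simp: B_def madj_matrix_unit matrix_unit_mult)
    also have "\<dots> = block_units M s s'"
      unfolding block_units_def using that by (simp add: b less_mult_imp_div_less matrix_unit_sum)
    finally show ?thesis by simp
  qed
  thus ?thesis unfolding mat_pos_def by blast
qed

lemma sum_swap_pairs:
  "(\<Sum>i\<in>A. \<Sum>j\<in>B. \<Sum>m\<in>C. \<Sum>r\<in>D. f i j m r) = (\<Sum>m\<in>C. \<Sum>r\<in>D. \<Sum>i\<in>A. \<Sum>j\<in>B. (f i j m r :: 'b::comm_monoid_add))"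
proof -
  have "(\<Sum>i\<in>A. \<Sum>j\<in>B. \<Sum>m\<in>C. \<Sum>r\<in>D. f i j m r) = (\<Sum>m\<in>C. \<Sum>i\<in>A. \<Sum>j\<in>B. \<Sum>r\<in>D. f i j m r)"
    by (subst sum.swap) (rule sum.cong[OF refl], rule sum.swap)
  also have "\<dots> = (\<Sum>m\<in>C. \<Sum>r\<in>D. \<Sum>i\<in>A. \<Sum>j\<in>B. f i j m r)"
    by (rule sum.cong[OF refl], subst sum.swap) (rule sum.cong[OF refl], rule sum.swap)
  finally show ?thesis .
qed

section \<open>Complete positivity of \<open>\<phi>\<close> and of \<open>hat \<phi>\<close>\<close>

text \<open>A positive \<open>M \<in> M\<^sub>k(M\<^sub>n(A))\<close> is a positive \<open>k n \<times> k n\<close> matrix over \<open>A\<close>; applying \<open>\<phi>\<close>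
  and summing the diagonal blocks exhibits \<open>hat \<phi> (M)\<close> as a Gram matrix of \<open>k n\<^sup>2\<close> vectors.\<close>

lemma completely_positive_hat:
  fixes \<phi> :: "'a::unital_cstar_algebra \<Rightarrow> 'u::unital_cstar_algebra^'n::finite^'n"
  assumes cp: "completely_positive (*) adj (**) madj \<phi>"
  shows "completely_positive (**) madj (*) adj (hat \<phi>)"
  unfolding completely_positive_def
proof (intro allI impI)
  fix k and M :: "nat \<Rightarrow> nat \<Rightarrow> 'a^'n^'n"
  assume "mat_pos (**) madj k M"
  hence "mat_pos (**) madj (k * CARD('n)) (\<lambda>s s'. \<phi> (block_entries M s s'))"
    using cp mat_pos_block_entries unfolding completely_positive_def by blast
  then obtain D where D: "\<And>s s'. s < k * CARD('n) \<Longrightarrow> s' < k * CARD('n) \<Longrightarrow>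
      \<phi> (block_entries M s s') = (\<Sum>m<k * CARD('n). madj (D m s) ** D m s')"
    unfolding mat_pos_def by blast
  define Y where "Y x p = (\<Sum>i\<in>UNIV. D (fst x) (blk p i) $ snd x $ i)" for x :: "nat \<times> 'n" and p
  have hat_gram: "hat \<phi> (M p q) = (\<Sum>x\<in>{..<k * CARD('n)} \<times> UNIV. adj (Y x p) * Y x q)"
    if "p < k" "q < k" for p q
  proof -
    have "M p q $ i $ j = block_entries M (blk p i) (blk q j)" for i j
      by (simp add: block_entries_def)
    hence "hat \<phi> (M p q) = (\<Sum>i\<in>UNIV. \<Sum>j\<in>UNIV. \<Sum>m<k * CARD('n). \<Sum>r\<in>UNIV.
        adj (D m (blk p i) $ r $ i) * D m (blk q j) $ r $ j)"
      unfolding hat_def using D blk_less[where 'n='n] that by (simp add: madj_mult_nth)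
    also have "\<dots> = (\<Sum>m<k * CARD('n). \<Sum>r\<in>UNIV. \<Sum>i\<in>UNIV. \<Sum>j\<in>UNIV.
        adj (D m (blk p i) $ r $ i) * D m (blk q j) $ r $ j)"
      by (rule sum_swap_pairs)
    also have "\<dots> = (\<Sum>m<k * CARD('n). \<Sum>r\<in>UNIV. adj (Y (m, r) p) * Y (m, r) q)"
      by (simp add: Y_def sum_product)
    also have "\<dots> = (\<Sum>x\<in>{..<k * CARD('n)} \<times> UNIV. adj (Y x p) * Y x q)"
      by (rule sum.cartesian_product'[symmetric])
    finally show ?thesis .
  qed
  have "mat_pos (*) adj k (\<lambda>p q. \<Sum>x\<in>{..<k * CARD('n)} \<times> UNIV. adj (Y x p) * Y x q)"
    by (rule mat_pos_gram) simp
  thus "mat_pos (*) adj k (\<lambda>i j. hat \<phi> (M i j))"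
    by (subst mat_pos_cong[OF hat_gram])
qed

lemma completely_positive_if_hat:
  fixes \<phi> :: "'a::unital_cstar_algebra \<Rightarrow> 'u::unital_cstar_algebra^'n::finite^'n"
  assumes \<phi>0: "\<phi> 0 = 0" and cp: "completely_positive (**) madj (*) adj (hat \<phi>)"
  shows "completely_positive (*) adj (**) madj \<phi>"
  unfolding completely_positive_def
proof (intro allI impI)
  fix k and M :: "nat \<Rightarrow> nat \<Rightarrow> 'a"
  assume "mat_pos (*) adj k M"
  hence "mat_pos (*) adj (k * CARD('n)) (\<lambda>s s'. hat \<phi> (block_units M s s'))"
    using cp mat_pos_block_units unfolding completely_positive_def by blast
  then obtain D where D: "\<And>s s'. s < k * CARD('n) \<Longrightarrow> s' < k * CARD('n) \<Longrightarrow>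
      hat \<phi> (block_units M s s') = (\<Sum>m<k * CARD('n). adj (D m s) * D m s')"
    unfolding mat_pos_def by blast
  define B :: "nat \<Rightarrow> nat \<Rightarrow> 'u^'n^'n" where "B l p = (\<chi> r i. D (blk l r) (blk p i))" for l p
  have "\<phi> (M p q) $ i $ j = (\<Sum>l<k. madj (B l p) ** B l q) $ i $ j" if "p < k" "q < k" for p q i j
  proof -
    have "\<phi> (M p q) $ i $ j = hat \<phi> (block_units M (blk p i) (blk q j))"
      by (simp add: block_units_def hat_matrix_unit \<phi>0)
    also have "\<dots> = (\<Sum>m<k * CARD('n). adj (D m (blk p i)) * D m (blk q j))"
      using D blk_less[where 'n='n] that by simp
    also have "\<dots> = (\<Sum>l<k. \<Sum>r\<in>(UNIV :: 'n set). adj (D (blk l r) (blk p i)) * D (blk l r) (blk q j))"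
      by (rule sum_blk)
    also have "\<dots> = (\<Sum>l<k. madj (B l p) ** B l q) $ i $ j"
      by (simp add: madj_mult_nth B_def)
    finally show ?thesis .
  qed
  thus "mat_pos (**) madj k (\<lambda>i j. \<phi> (M i j))"
    unfolding mat_pos_def by (intro exI[where x=B]) (simp add: vec_eq_iff)
qed

section \<open>The bijection\<close>

definition hat_inv :: "('a^'n::finite^'n \<Rightarrow> 'u) \<Rightarrow> 'a::zero \<Rightarrow> 'u^'n^'n" where
  "hat_inv \<psi> a = (\<chi> i j. \<psi> (matrix_unit i j a))"

lemma module_map_zero: "module_map scX actX scY actY f \<Longrightarrow> f 0 = 0"
  for f :: "'x::ab_group_add \<Rightarrow> 'y::ab_group_add"
  unfolding module_map_def by (blast intro: additive.zero additive.intro)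

lemma inj_on_hat: "inj_on hat {\<phi> :: 'a::zero \<Rightarrow> 'u::comm_monoid_add^'n::finite^'n. \<phi> 0 = 0}"
proof (rule inj_onI)
  fix \<phi> \<psi> :: "'a \<Rightarrow> 'u^'n^'n"
  assume "\<phi> \<in> {\<phi>. \<phi> 0 = 0}" "\<psi> \<in> {\<phi>. \<phi> 0 = 0}" "hat \<phi> = hat \<psi>"
  hence "\<phi> a $ i $ j = \<psi> a $ i $ j" for a i j
    using hat_matrix_unit[of \<phi> i j a] hat_matrix_unit[of \<psi> i j a] by simp
  thus "\<phi> = \<psi>" by (simp add: vec_eq_iff fun_eq_iff)
qed

lemma hat_hat_inv:
  fixes \<psi> :: "'a::ab_group_add^'n::finite^'n \<Rightarrow> 'u::ab_group_add"
  assumes "\<And>x y. \<psi> (x + y) = \<psi> x + \<psi> y"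
  shows "hat (hat_inv \<psi>) = \<psi>"
proof
  fix X :: "'a^'n^'n"
  have "hat (hat_inv \<psi>) X = \<psi> (\<Sum>i\<in>UNIV. \<Sum>j\<in>UNIV. matrix_unit i j (X $ i $ j))"
    unfolding hat_def hat_inv_def by (simp add: additive.sum[OF additive.intro, OF assms])
  thus "hat (hat_inv \<psi>) X = \<psi> X" by (simp add: sum_matrix_units)
qed

lemma module_map_hat:
  fixes \<phi> :: "'a::unital_cstar_algebra \<Rightarrow> 'u::unital_cstar_algebra^'n::finite^'n"
  assumes "module_map scC act mscC mlmult \<phi>"
  shows "module_map mscC (mact act) scC (*) (hat \<phi>)"
  using assms unfolding module_map_def hat_def
  by (simp add: sum.distrib mscC_def scC_sum mact_def mlmult_def sum_distrib_left)

lemma module_map_hat_inv: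
  fixes \<psi> :: "'a::unital_cstar_algebra^'n::finite^'n \<Rightarrow> 'u::unital_cstar_algebra"
  assumes act: "unital_AC_module act" and \<psi>: "module_map mscC (mact act) scC (*) \<psi>"
  shows "module_map scC act mscC mlmult (hat_inv \<psi>)"
  unfolding module_map_def
proof (intro conjI allI)
  have add: "\<psi> (x + y) = \<psi> x + \<psi> y" and sc: "\<psi> (mscC c x) = scC c (\<psi> x)"
    and ac: "\<psi> (mact act \<alpha> x) = \<alpha> * \<psi> x" for x y c \<alpha>
    using \<psi> unfolding module_map_def by blast+
  have "act \<alpha> (0 + 0) = act \<alpha> 0 + act \<alpha> 0" for \<alpha>
    using act unfolding unital_AC_module_def by blast
  hence "act \<alpha> 0 = 0" for \<alpha> by simp
  hence unit_act: "matrix_unit i j (act \<alpha> x) = mact act \<alpha> (matrix_unit i j x)" for i j :: 'n and \<alpha> x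
    by (simp add: vec_eq_iff mact_def)
  have unit_sc: "matrix_unit i j (scC c x) = mscC c (matrix_unit i j x)" for i j :: 'n and c x
    by (simp add: vec_eq_iff mscC_def)
  fix x y c \<alpha>
  show "hat_inv \<psi> (x + y) = hat_inv \<psi> x + hat_inv \<psi> y"
    by (simp add: hat_inv_def vec_eq_iff matrix_unit_add add)
  show "hat_inv \<psi> (scC c x) = mscC c (hat_inv \<psi> x)"
    by (simp add: hat_inv_def unit_sc sc) (simp add: vec_eq_iff mscC_def)
  show "hat_inv \<psi> (act \<alpha> x) = mlmult \<alpha> (hat_inv \<psi> x)"
    by (simp add: hat_inv_def vec_eq_iff mlmult_def unit_act ac)
qed

theorem lemma3p7:
  fixes act :: "'u::unital_cstar_algebra \<Rightarrow> 'a::unital_cstar_algebra \<Rightarrow> 'a"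
  assumes "unital_AC_module act"
  shows "bij_betw (hat :: ('a \<Rightarrow> 'u^'n::finite^'n) \<Rightarrow> _) (CP_A_Mn act) (CP_MnA_U act)
    \<and> (\<forall>\<phi> :: 'a \<Rightarrow> 'u^'n^'n. module_map scC act mscC mlmult \<phi> \<longrightarrow>
          (completely_positive (*) adj (**) madj \<phi> \<longleftrightarrow>
           completely_positive (**) madj (*) adj (hat \<phi>)))"
proof -
  have cp_iff: "completely_positive (*) adj (**) madj \<phi> \<longleftrightarrow> completely_positive (**) madj (*) adj (hat \<phi>)"
    if "module_map scC act mscC mlmult \<phi>" for \<phi> :: "'a \<Rightarrow> 'u^'n^'n"
    using completely_positive_hat completely_positive_if_hat[of \<phi>, OF module_map_zero[OF that]] by blast
  have "inj_on (hat :: ('a \<Rightarrow> 'u^'n^'n) \<Rightarrow> _) (CP_A_Mn act)"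
    by (rule inj_on_subset[OF inj_on_hat]) (auto simp: CP_A_Mn_def intro: module_map_zero)
  moreover have "hat ` CP_A_Mn act \<subseteq> (CP_MnA_U act :: ('a^'n^'n \<Rightarrow> 'u) set)"
    using module_map_hat cp_iff by (auto simp: CP_A_Mn_def CP_MnA_U_def)
  moreover have "\<psi> \<in> hat ` CP_A_Mn act" if "\<psi> \<in> CP_MnA_U act" for \<psi> :: "'a^'n^'n \<Rightarrow> 'u"
  proof -
    have \<psi>: "module_map mscC (mact act) scC (*) \<psi>" "completely_positive (**) madj (*) adj \<psi>"
      using that by (auto simp: CP_MnA_U_def)
    have "hat (hat_inv \<psi>) = \<psi>" using \<psi>(1) by (intro hat_hat_inv) (simp add: module_map_def)
    moreover have "hat_inv \<psi> \<in> CP_A_Mn act"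
      using module_map_hat_inv[OF assms \<psi>(1)] cp_iff \<psi>(2) calculation by (auto simp: CP_A_Mn_def)
    ultimately show ?thesis by (metis image_eqI)
  qed
  ultimately show ?thesis using cp_iff unfolding bij_betw_def by blast
qed

end
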